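(* Let $V$ be an optimal prefix-free machine, and for real $T>0$ let $\Theta_V(T)=\sum_{s\in\{0,1\}^*,\,H_V(s)<|s|}2^{-|s|/T}$. For every $T\in(0,1)$, if $\Theta_V(T)$ is computable, then $T$ is weakly Chaitin $T$-random and $T$-compressible.
   Context: $\{0,1\}^*$ is the set of finite binary strings; $|s|$ is the length of $s$. A prefix-free machine is a partial recursive function $C:\{0,1\}^*\to\{0,1\}^*$ whose domain is prefix-free. $H_C(s)=\min\{|p| : C(p)=s\}$ (possibly $\infty$). A prefix-free machine $U$ is optimal if for every prefix-free machine $C$ there is $d\in\mathbb{N}$ such that for every $p\in\mathrm{Dom}\,C$ there is $q\in\mathrm{Dom}\,U$ with $U(q)=C(p)$ and $|q|\le|p|+d$. A particular optimal prefix-free machine $U$ is fixed and $H(s):=H_U(s)$. For a real $\alpha$ and $n\ge1$, $\alpha\restriction n$ denotes the first $n$ bits of the base-two expansion of $\alpha-\lfloor\alpha\rfloor$ (the expansion with infinitely many zeros). A real $\alpha$ is computable if there is a total recursive $f:\mathbb{N}^+\to\mathbb{Q}$ with $|\alpha-f(n)|<1/n$ for all $n$. For $T\in(0,1]$, $\alpha$ is weakly Chaitin $T$-random if there is $c\in\mathbb{N}$ with $Tn-c\le H(\alpha\restriction n)$ for all $n\in\mathbb{N}^+$; $\alpha$ is $T$-compressible if $\limsup_{n\to\infty}H(\alpha\restriction n)/n\le T$. *)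

theory Defs
  imports "HOL-Analysis.Analysis" "HOL-Library.Sublist" "HOL-Library.Extended_Real"
begin

datatype recf = Zero | Succ | Proj nat | Comp recf "recf list" | Prim recf recf | Mn recf

inductive eval_recf :: "recf \<Rightarrow> nat list \<Rightarrow> nat \<Rightarrow> bool" where
  ev_zero: "eval_recf Zero xs 0"
| ev_succ: "eval_recf Succ (x # xs) (Suc x)"
| ev_proj: "i < length xs \<Longrightarrow> eval_recf (Proj i) xs (xs ! i)"
| ev_comp: "list_all2 (\<lambda>g y. eval_recf g xs y) gs ys \<Longrightarrow> eval_recf f ys z
            \<Longrightarrow> eval_recf (Comp f gs) xs z"
| ev_prim0: "eval_recf f xs y \<Longrightarrow> eval_recf (Prim f g) (0 # xs) y"
| ev_primS: "eval_recf (Prim f g) (n # xs) y \<Longrightarrow> eval_recf g (y # n # xs) z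
            \<Longrightarrow> eval_recf (Prim f g) (Suc n # xs) z"
| ev_mn: "eval_recf f (n # xs) 0 \<Longrightarrow> (\<forall>m<n. \<exists>y. eval_recf f (m # xs) y \<and> y \<noteq> 0)
            \<Longrightarrow> eval_recf (Mn f) xs n"

definition partial_recursive :: "(nat \<Rightarrow> nat option) \<Rightarrow> bool" where
  "partial_recursive \<phi> \<longleftrightarrow> (\<exists>f. \<forall>x y. eval_recf f [x] y \<longleftrightarrow> \<phi> x = Some y)"

definition total_recursive :: "(nat \<Rightarrow> nat) \<Rightarrow> bool" where
  "total_recursive a \<longleftrightarrow> partial_recursive (\<lambda>n. Some (a n))"

text \<open>Binary strings are bool list (True = 1). Standard bijection
  with the naturals: the string s is sent to (value of the binary numeral 1s) - 1.\<close>
definition str_code :: "bool list \<Rightarrow> nat" where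
  "str_code s = (\<Sum>i<length s. (if s ! i then 1 else 0) * 2 ^ (length s - 1 - i)) + 2 ^ length s - 1"

definition partial_recursive_str :: "(bool list \<Rightarrow> bool list option) \<Rightarrow> bool" where
  "partial_recursive_str C \<longleftrightarrow>
     (\<exists>\<phi>. partial_recursive \<phi> \<and> (\<forall>p. \<phi> (str_code p) = map_option str_code (C p)))"

definition prefix_free :: "bool list set \<Rightarrow> bool" where
  "prefix_free A \<longleftrightarrow> (\<forall>p\<in>A. \<forall>q\<in>A. prefix p q \<longrightarrow> p = q)"

definition prefix_free_machine :: "(bool list \<Rightarrow> bool list option) \<Rightarrow> bool" where
  "prefix_free_machine C \<longleftrightarrow> partial_recursive_str C \<and> prefix_free (dom C)"

definition Hc :: "(bool list \<Rightarrow> bool list option) \<Rightarrow> bool list \<Rightarrow> enat" where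
  "Hc C s = (INF p \<in> {p. C p = Some s}. enat (length p))"

definition optimal_machine :: "(bool list \<Rightarrow> bool list option) \<Rightarrow> bool" where
  "optimal_machine U \<longleftrightarrow> prefix_free_machine U \<and>
     (\<forall>C. prefix_free_machine C \<longrightarrow>
        (\<exists>d::nat. \<forall>p \<in> dom C. \<exists>q \<in> dom U. U q = C p \<and> length q \<le> length p + d))"

text \<open>First n bits of the base-two expansion (with infinitely many zeros) of
  the fractional part of x; bit i (i \<ge> 1) is floor(2^i frac x) mod 2.\<close>
definition prefix_bits :: "real \<Rightarrow> nat \<Rightarrow> bool list" where
  "prefix_bits x n = map (\<lambda>i. odd \<lfloor>2 ^ (i + 1) * frac x\<rfloor>) [0..<n]"

text \<open>Computable real: total recursive approximation by rationals;
  the rational f(n) is represented as (a n - b n)/(c n + 1).\<close>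
definition computable_real :: "real \<Rightarrow> bool" where
  "computable_real x \<longleftrightarrow> (\<exists>a b c. total_recursive a \<and> total_recursive b \<and> total_recursive c \<and>
     (\<forall>n\<ge>1. \<bar>x - (real (a n) - real (b n)) / real (c n + 1)\<bar> < 1 / real n))"

definition weakly_Chaitin_random :: "(bool list \<Rightarrow> bool list option) \<Rightarrow> real \<Rightarrow> real \<Rightarrow> bool" where
  "weakly_Chaitin_random U T \<alpha> \<longleftrightarrow>
     (\<exists>c::nat. \<forall>n\<ge>1. ereal (T * real n - real c) \<le> ereal_of_enat (Hc U (prefix_bits \<alpha> n)))"

definition compressible :: "(bool list \<Rightarrow> bool list option) \<Rightarrow> real \<Rightarrow> real \<Rightarrow> bool" where
  "compressible U T \<alpha> \<longleftrightarrow>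
     limsup (\<lambda>n. ereal_of_enat (Hc U (prefix_bits \<alpha> n)) / ereal (real n)) \<le> ereal T"

definition Theta :: "(bool list \<Rightarrow> bool list option) \<Rightarrow> real \<Rightarrow> real" where
  "Theta V T = (\<Sum>\<^sub>\<infinity> s \<in> {s. Hc V s < enat (length s)}. 2 powr (- real (length s) / T))"

end

theory Submission
  imports Defs
begin

text \<open>
  Let \<open>A\<close> be the recursively enumerable set of strings with \<open>H\<^sub>V(s) < |s|\<close>, let \<open>A\<^sub>k\<close> be the part of
  it enumerated by stage \<open>k\<close>, and let \<open>Z\<^sub>k(t)\<close> be the sum of \<open>2\<^bsup>-|s|/t\<^esup>\<close> over \<open>A\<^sub>k\<close>, which increases
  to \<open>\<Theta>\<^sub>V(t)\<close>. By Kraft's inequality the sum of \<open>2\<^bsup>-|s|\<^esup>\<close> over \<open>A\<close> is at most \<open>1/2\<close>.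

  Randomness: given the first \<open>n\<close> bits of \<open>T\<close>, search for a stage \<open>k\<close> with \<open>Z\<^sub>k(t)\<close> above
  \<open>\<Theta>\<^sub>V(T) - O(2\<^bsup>-n\<^esup>)\<close>, where \<open>T < t \<le> T + 2\<^bsup>-n\<^esup>\<close>. As \<open>Z\<^sub>k\<close> is Lipschitz near \<open>T\<close> uniformly in
  \<open>k\<close>, every element of \<open>A\<close> outside \<open>A\<^sub>k\<close> has weight \<open>O(2\<^bsup>-n\<^esup>)\<close>, hence length at least
  \<open>T n - O(1)\<close>. A slightly shorter string outside \<open>A\<^sub>k\<close> is therefore outside \<open>A\<close>, and it has
  complexity at least \<open>T n - O(1)\<close> although it was computed from those \<open>n\<close> bits.

  Compressibility: let \<open>T' \<ge> T\<close> be rational. The first \<open>T' n\<close> bits of the Kraft sum over \<open>A\<close> yield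
  a stage \<open>k\<close> after which less than \<open>2\<^bsup>-T' n\<^esup>\<close> of it is missing. The strings of \<open>A\<close> outside \<open>A\<^sub>k\<close>
  are then longer than \<open>T' n\<close>, so they contribute at most \<open>2\<^bsup>-T' n\<^esup> \<cdot> 2\<^bsup>-T' n (1/T - 1)\<^esup> \<le> 2\<^bsup>-n\<^esup>\<close>
  to \<open>\<Theta>\<^sub>V(T)\<close>. Since \<open>Z\<^sub>k\<close> grows at a positive rate, solving \<open>Z\<^sub>k(t) = \<Theta>\<^sub>V(T)\<close> approximately gives
  \<open>T\<close> up to \<open>O(2\<^bsup>-n\<^esup>)\<close>, and about \<open>T' n\<close> bits suffice to describe the first \<open>n\<close> bits of \<open>T\<close>.
\<close>

section \<open>Recursive functions of an environment\<close>

text \<open>Functions of several arguments are functions of an environment \<open>e :: nat \<Rightarrow> nat\<close>, of which only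
  a finite initial part is read; binding a variable shifts the environment by one.\<close>

definition rec_env :: "((nat \<Rightarrow> nat) \<Rightarrow> nat) \<Rightarrow> bool" where
  "rec_env F \<longleftrightarrow> (\<exists>r k. \<forall>k'\<ge>k. \<forall>e y. eval_recf r (map e [0..<k']) y \<longleftrightarrow> y = F e)"

definition dec_env :: "((nat \<Rightarrow> nat) \<Rightarrow> bool) \<Rightarrow> bool" where
  "dec_env P \<longleftrightarrow> rec_env (\<lambda>e. if P e then 1 else 0)"

definition recursive2 :: "(nat \<Rightarrow> nat \<Rightarrow> nat) \<Rightarrow> bool" where
  "recursive2 f \<longleftrightarrow> rec_env (\<lambda>e. f (e 0) (e (Suc 0)))"

definition recursive3 :: "(nat \<Rightarrow> nat \<Rightarrow> nat \<Rightarrow> nat) \<Rightarrow> bool" where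
  "recursive3 f \<longleftrightarrow> rec_env (\<lambda>e. f (e 0) (e (Suc 0)) (e (Suc (Suc 0))))"

definition decidable2 :: "(nat \<Rightarrow> nat \<Rightarrow> bool) \<Rightarrow> bool" where
  "decidable2 P \<longleftrightarrow> dec_env (\<lambda>e. P (e 0) (e (Suc 0)))"

definition decidable3 :: "(nat \<Rightarrow> nat \<Rightarrow> nat \<Rightarrow> bool) \<Rightarrow> bool" where
  "decidable3 P \<longleftrightarrow> dec_env (\<lambda>e. P (e 0) (e (Suc 0)) (e (Suc (Suc 0))))"

inductive_simps eval_Zero: "eval_recf Zero xs y"
inductive_simps eval_Succ: "eval_recf Succ xs y"
inductive_simps eval_Proj: "eval_recf (Proj i) xs y"
inductive_simps eval_Comp: "eval_recf (Comp f gs) xs y"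
inductive_simps eval_Prim_0: "eval_recf (Prim f g) (0 # xs) y"
inductive_simps eval_Prim_Suc: "eval_recf (Prim f g) (Suc n # xs) y"
inductive_simps eval_Mn: "eval_recf (Mn f) xs y"

named_theorems rec_env_intros

lemma rec_envI:
  assumes "\<And>k' e y. k \<le> k' \<Longrightarrow> eval_recf r (map e [0..<k']) y \<longleftrightarrow> y = F e"
  shows "rec_env F"
  using assms unfolding rec_env_def by blast

lemma rec_env_var [rec_env_intros]: "rec_env (\<lambda>e. e i)"
  by (rule rec_envI[of "Suc i" "Proj i"]) (auto simp: eval_Proj)

lemma list_all2_eval_map:
  assumes "\<And>i y. i < k \<Longrightarrow> eval_recf (rs i) xs y \<longleftrightarrow> y = v i"
  shows "list_all2 (\<lambda>g y. eval_recf g xs y) (map rs [0..<k]) ys \<longleftrightarrow> ys = map v [0..<k]"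
proof -
  have "list_all2 (\<lambda>g y. eval_recf g xs y) (map rs [0..<k]) ys \<longleftrightarrow>
      length ys = k \<and> (\<forall>i<k. ys ! i = v i)"
    using assms by (auto simp: list_all2_conv_all_nth)
  also have "\<dots> \<longleftrightarrow> ys = map v [0..<k]"
    by (auto intro: nth_equalityI)
  finally show ?thesis .
qed

lemma rec_env_subst:
  assumes rec_F: "rec_env F" and rec_subst: "\<And>i. rec_env (\<sigma> i)"
  shows "rec_env (\<lambda>e. F (\<lambda>i. \<sigma> i e))"
proof -
  obtain r k where eval_r: "\<forall>k'\<ge>k. \<forall>e y. eval_recf r (map e [0..<k']) y \<longleftrightarrow> y = F e"
    using rec_F unfolding rec_env_def by blast
  have "\<forall>i. \<exists>ri ki. \<forall>k'\<ge>ki. \<forall>e y. eval_recf ri (map e [0..<k']) y \<longleftrightarrow> y = \<sigma> i e"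
    using rec_subst unfolding rec_env_def by blast
  then obtain rs ks where
    eval_rs: "\<And>i k' e y. ks i \<le> k' \<Longrightarrow> eval_recf (rs i) (map e [0..<k']) y \<longleftrightarrow> y = \<sigma> i e"
    by metis
  show ?thesis
  proof (rule rec_envI[of "\<Sum>i<k. ks i" "Comp r (map rs [0..<k])"])
    fix k' e y assume k'_ge: "(\<Sum>i<k. ks i) \<le> k'"
    have "ks i \<le> k'" if "i < k" for i
      using member_le_sum[of i "{..<k}" ks] that k'_ge by simp
    then have "list_all2 (\<lambda>g y. eval_recf g (map e [0..<k']) y) (map rs [0..<k]) ys
        \<longleftrightarrow> ys = map (\<lambda>i. \<sigma> i e) [0..<k]" for ys
      by (intro list_all2_eval_map) (simp add: eval_rs)
    then show "eval_recf (Comp r (map rs [0..<k])) (map e [0..<k']) y \<longleftrightarrow> y = F (\<lambda>i. \<sigma> i e)"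
      by (simp add: eval_Comp eval_r)
  qed
qed

lemma rec_env_shift: "rec_env F \<Longrightarrow> rec_env (\<lambda>e. F (\<lambda>i. e (Suc i)))"
  using rec_env_subst[of F "\<lambda>i e. e (Suc i)"] rec_env_var by simp

lemma dec_env_skip:
  assumes "dec_env (\<lambda>e. P (e 0) (\<lambda>i. e (Suc i)))"
  shows "dec_env (\<lambda>e. P (e 0) (\<lambda>i. e (Suc (Suc i))))"
proof -
  define skip :: "nat \<Rightarrow> (nat \<Rightarrow> nat) \<Rightarrow> nat"
    where "skip i e = (case i of 0 \<Rightarrow> e 0 | Suc i \<Rightarrow> e (Suc (Suc i)))" for i e
  have "rec_env (skip i)" for i
    unfolding skip_def by (cases i) (simp_all add: rec_env_var)
  then show ?thesis
    using rec_env_subst[OF assms[unfolded dec_env_def], of skip] by (simp add: dec_env_def skip_def)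
qed

lemma rec_env_recursive2:
  assumes "recursive2 f" "rec_env F" "rec_env G"
  shows "rec_env (\<lambda>e. f (F e) (G e))"
proof -
  have "rec_env (case_nat F (\<lambda>_. G) i)" for i
    using assms(2-) by (simp split: nat.split)
  then show ?thesis
    using rec_env_subst[OF assms(1)[unfolded recursive2_def], of "case_nat F (\<lambda>_. G)"] by simp
qed

lemma rec_env_recursive3:
  assumes "recursive3 f" "rec_env F" "rec_env G" "rec_env H"
  shows "rec_env (\<lambda>e. f (F e) (G e) (H e))"
proof -
  have "rec_env (case_nat F (case_nat G (\<lambda>_. H)) i)" for i
    using assms(2-) by (simp split: nat.split)
  then show ?thesis
    using rec_env_subst[OF assms(1)[unfolded recursive3_def], of "case_nat F (case_nat G (\<lambda>_. H))"]
    by simp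
qed

lemma dec_env_decidable2:
  assumes "decidable2 P" "rec_env F" "rec_env G"
  shows "dec_env (\<lambda>e. P (F e) (G e))"
  using rec_env_recursive2[OF _ assms(2,3)] assms(1)
  by (simp add: decidable2_def dec_env_def recursive2_def)

lemma dec_env_decidable3:
  assumes "decidable3 P" "rec_env F" "rec_env G" "rec_env H"
  shows "dec_env (\<lambda>e. P (F e) (G e) (H e))"
  using rec_env_recursive3[OF _ assms(2-4)] assms(1)
  by (simp add: decidable3_def dec_env_def recursive3_def)

lemma rec_env_total_recursive:
  assumes "total_recursive f" "rec_env F"
  shows "rec_env (\<lambda>e. f (F e))"
proof -
  obtain r where eval_r: "\<And>x y. eval_recf r [x] y \<longleftrightarrow> f x = y"
    using assms(1) unfolding total_recursive_def partial_recursive_def by auto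
  have "rec_env (\<lambda>e. f (e 0))"
  proof (rule rec_envI[of 1 "Comp r (map Proj [0..<1])"])
    fix k' :: nat and e y assume "1 \<le> k'"
    then have "list_all2 (\<lambda>g y. eval_recf g (map e [0..<k']) y) (map Proj [0..<1]) ys
        \<longleftrightarrow> ys = map e [0..<1]" for ys
      by (intro list_all2_eval_map) (auto simp: eval_Proj)
    then show "eval_recf (Comp r (map Proj [0..<1])) (map e [0..<k']) y \<longleftrightarrow> y = f (e 0)"
      by (auto simp: eval_Comp eval_r)
  qed
  from rec_env_subst[OF this, of "\<lambda>_. F"] assms(2) show ?thesis by simp
qed

lemma rec_env_Suc [rec_env_intros]:
  assumes "rec_env F"
  shows "rec_env (\<lambda>e. Suc (F e))"
proof (rule rec_env_total_recursive[OF _ assms])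
  have "eval_recf Succ [x] y \<longleftrightarrow> Suc x = y" for x y
    by (auto simp: eval_Succ)
  then show "total_recursive Suc"
    unfolding total_recursive_def partial_recursive_def by auto
qed

lemma rec_env_const [rec_env_intros]: "rec_env (\<lambda>_. n)"
proof (induction n)
  case 0
  show ?case by (rule rec_envI[of 0 Zero]) (auto simp: eval_Zero)
next
  case (Suc n)
  then show ?case by (rule rec_env_Suc)
qed

lemma rec_env_primrec:
  assumes rec_G: "rec_env G"
    and rec_h: "rec_env (\<lambda>e. h (e 0) (e (Suc 0)) (\<lambda>i. e (Suc (Suc i))))"
    and rec_N: "rec_env N"
  shows "rec_env (\<lambda>e. rec_nat (G e) (\<lambda>i r. h r i e) (N e))"
proof -
  obtain rG kG where eval_rG: "\<forall>k'\<ge>kG. \<forall>e y. eval_recf rG (map e [0..<k']) y \<longleftrightarrow> y = G e"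
    using rec_G unfolding rec_env_def by blast
  obtain rH kH where eval_rH: "\<forall>k'\<ge>kH. \<forall>e y. eval_recf rH (map e [0..<k']) y \<longleftrightarrow>
      y = h (e 0) (e (Suc 0)) (\<lambda>i. e (Suc (Suc i)))"
    using rec_h unfolding rec_env_def by blast
  obtain rN kN where eval_rN: "\<forall>k'\<ge>kN. \<forall>e y. eval_recf rN (map e [0..<k']) y \<longleftrightarrow> y = N e"
    using rec_N unfolding rec_env_def by blast
  define K where "K = kG + kH + kN"
  have step: "eval_recf rH (a # n # map e [0..<K]) y \<longleftrightarrow> y = h a n e" for a n e y
    using eval_rH[rule_format, of "Suc (Suc K)" "case_nat a (case_nat n e)" y]
    by (simp add: K_def map_upt_Suc del: upt_Suc)
  have base: "eval_recf rG (map e [0..<K]) y \<longleftrightarrow> y = G e" for e y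
    by (simp add: eval_rG K_def)
  have iterate: "eval_recf (Prim rG rH) (n # map e [0..<K]) y \<longleftrightarrow>
      y = rec_nat (G e) (\<lambda>i r. h r i e) n" for n e y
    by (induction n arbitrary: y) (simp_all add: eval_Prim_0 eval_Prim_Suc base step)
  show ?thesis
  proof (rule rec_envI[of K "Comp (Prim rG rH) (rN # map Proj [0..<K])"])
    fix k' e y assume k'_ge: "K \<le> k'"
    have "list_all2 (\<lambda>g y. eval_recf g (map e [0..<k']) y) (map Proj [0..<K]) ys
        \<longleftrightarrow> ys = map e [0..<K]" for ys
      using k'_ge by (intro list_all2_eval_map) (auto simp: eval_Proj)
    moreover have "eval_recf rN (map e [0..<k']) y \<longleftrightarrow> y = N e" for y
      using k'_ge by (intro eval_rN[rule_format]) (simp add: K_def)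
    ultimately show "eval_recf (Comp (Prim rG rH) (rN # map Proj [0..<K])) (map e [0..<k']) y
        \<longleftrightarrow> y = rec_nat (G e) (\<lambda>i r. h r i e) (N e)"
      by (auto simp: eval_Comp list_all2_Cons1 iterate)
  qed
qed

lemma rec_env_add [rec_env_intros]:
  assumes "rec_env F" "rec_env G" shows "rec_env (\<lambda>e. F e + G e)"
proof -
  have "rec_nat a (\<lambda>i r. Suc r) b = a + b" for a b :: nat by (induction b) auto
  then show ?thesis
    using rec_env_primrec[OF assms(1) _ assms(2), of "\<lambda>r i e. Suc r"]
    by (simp add: rec_env_Suc rec_env_var)
qed

lemma rec_env_mult [rec_env_intros]:
  assumes "rec_env F" "rec_env G" shows "rec_env (\<lambda>e. F e * G e)"
proof -
  have "rec_nat 0 (\<lambda>i r. r + a) b = a * b" for a b :: nat by (induction b) auto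
  moreover have "rec_env (\<lambda>e. e 0 + F (\<lambda>i. e (Suc (Suc i))))"
    by (intro rec_env_intros assms(1)[THEN rec_env_shift, THEN rec_env_shift])
  ultimately show ?thesis
    using rec_env_primrec[OF rec_env_const[of 0] _ assms(2), of "\<lambda>r i e. r + F e"] by simp
qed

lemma rec_env_power [rec_env_intros]:
  assumes "rec_env F" "rec_env G" shows "rec_env (\<lambda>e. F e ^ G e)"
proof -
  have "rec_nat 1 (\<lambda>i r. r * a) b = a ^ b" for a b :: nat by (induction b) auto
  moreover have "rec_env (\<lambda>e. e 0 * F (\<lambda>i. e (Suc (Suc i))))"
    by (intro rec_env_intros assms(1)[THEN rec_env_shift, THEN rec_env_shift])
  ultimately show ?thesis
    using rec_env_primrec[OF rec_env_const[of 1] _ assms(2), of "\<lambda>r i e. r * F e"] by simp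
qed

lemma rec_env_diff [rec_env_intros]:
  assumes "rec_env F" "rec_env G" shows "rec_env (\<lambda>e. F e - G e)"
proof -
  have "rec_nat 0 (\<lambda>i r. i) b = b - 1" for b :: nat by (cases b) auto
  then have "rec_env (\<lambda>e. e 0 - 1)"
    using rec_env_primrec[OF rec_env_const[of 0] _ rec_env_var[of 0], of "\<lambda>r i e. i"]
    by (simp add: rec_env_var)
  moreover have "rec_nat a (\<lambda>i r. r - 1) b = a - b" for a b :: nat by (induction b) auto
  ultimately show ?thesis
    using rec_env_primrec[OF assms(1) _ assms(2), of "\<lambda>r i e. r - 1"] by simp
qed

lemma rec_env_sum [rec_env_intros]:
  assumes "rec_env B" "rec_env (\<lambda>e. f (e 0) (\<lambda>i. e (Suc i)))"
  shows "rec_env (\<lambda>e. \<Sum>i<B e. f i e)"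
proof -
  have "rec_nat 0 (\<lambda>i r. r + g i) b = (\<Sum>i<b. g i)" for b :: nat and g :: "nat \<Rightarrow> nat"
    by (induction b) auto
  moreover have "rec_env (\<lambda>e. e 0 + f (e (Suc 0)) (\<lambda>i. e (Suc (Suc i))))"
    by (intro rec_env_intros rec_env_shift[OF assms(2)])
  ultimately show ?thesis
    using rec_env_primrec[OF rec_env_const[of 0] _ assms(1), of "\<lambda>r i e. r + f i e"] by simp
qed

lemma dec_env_eq_0: assumes "rec_env F" shows "dec_env (\<lambda>e. F e = 0)"
proof -
  have "(if F e = 0 then 1 else 0) = 1 - F e" for e by auto
  then show ?thesis unfolding dec_env_def
    by (simp only:) (intro rec_env_intros assms)
qed

lemma dec_env_not [rec_env_intros]: assumes "dec_env P" shows "dec_env (\<lambda>e. \<not> P e)"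
proof -
  have "(\<lambda>e. \<not> P e) = (\<lambda>e. (if P e then 1 else 0 :: nat) = 0)" by auto
  then show ?thesis using dec_env_eq_0[OF assms[unfolded dec_env_def]] by (simp only:)
qed

lemma dec_env_conj [rec_env_intros]:
  assumes "dec_env P" "dec_env Q" shows "dec_env (\<lambda>e. P e \<and> Q e)"
proof -
  have "(if P e \<and> Q e then 1 else 0) = (if P e then 1 else 0) * (if Q e then 1 else 0 :: nat)" for e
    by simp
  then show ?thesis
    using rec_env_mult[OF assms[unfolded dec_env_def]] unfolding dec_env_def by (simp only:)
qed

lemma dec_env_le [rec_env_intros]:
  assumes "rec_env F" "rec_env G" shows "dec_env (\<lambda>e. F e \<le> G e)"
  using dec_env_eq_0[OF rec_env_diff[OF assms]] by simp

lemma dec_env_less [rec_env_intros]: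
  assumes "rec_env F" "rec_env G" shows "dec_env (\<lambda>e. F e < G e)"
  using dec_env_not[OF dec_env_le[OF assms(2,1)]] by (simp add: not_le)

lemma dec_env_eq [rec_env_intros]:
  assumes "rec_env F" "rec_env G" shows "dec_env (\<lambda>e. F e = G e)"
  using dec_env_conj[OF dec_env_le[OF assms] dec_env_le[OF assms(2,1)]]
  by (simp add: eq_iff)

lemma rec_env_if [rec_env_intros]:
  assumes "dec_env P" "rec_env F" "rec_env G"
  shows "rec_env (\<lambda>e. if P e then F e else G e)"
proof -
  have "(if P e then F e else G e) =
      (if P e then 1 else 0) * F e + (if \<not> P e then 1 else 0) * G e" for e by simp
  then show ?thesis
    by (simp only:) (intro rec_env_add rec_env_mult assms dec_env_not[unfolded dec_env_def]
      assms(1)[unfolded dec_env_def])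
qed

primrec bounded_least :: "(nat \<Rightarrow> bool) \<Rightarrow> nat \<Rightarrow> nat" where
  "bounded_least P 0 = 0"
| "bounded_least P (Suc b) =
    (if P (bounded_least P b) then bounded_least P b else Suc (bounded_least P b))"

lemma not_less_bounded_least: "m < bounded_least P b \<Longrightarrow> \<not> P m"
  by (induction b) (auto split: if_splits simp: less_Suc_eq)

lemma bounded_least_le: "P m \<Longrightarrow> bounded_least P b \<le> m"
  using not_less_bounded_least not_less by blast

lemma bounded_least_less_imp: "bounded_least P b < b \<Longrightarrow> P (bounded_least P b)"
  by (induction b) (auto split: if_splits)

lemma bounded_leastI: "P m \<Longrightarrow> m < b \<Longrightarrow> P (bounded_least P b)"
  by (rule bounded_least_less_imp) (rule le_less_trans[OF bounded_least_le])

lemma bounded_least_less_iff: "bounded_least P b < b \<longleftrightarrow> (\<exists>m<b. P m)"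
  using bounded_least_less_imp[of P b] le_less_trans[OF bounded_least_le[of P _ b], of _ b] by blast

lemma bounded_least_eqI:
  assumes "P n" "n < b" "\<And>m. m < n \<Longrightarrow> \<not> P m"
  shows "bounded_least P b = n"
  using bounded_least_le[of P n b] bounded_leastI[of P n b] assms by (meson le_neq_implies_less)

lemma rec_env_bounded_least [rec_env_intros]:
  assumes "rec_env B" "dec_env (\<lambda>e. P (e 0) (\<lambda>i. e (Suc i)))"
  shows "rec_env (\<lambda>e. bounded_least (\<lambda>i. P i e) (B e))"
proof -
  have "bounded_least Q b = rec_nat 0 (\<lambda>i r. if Q r then r else Suc r) b" for Q b
    by (induction b) auto
  then show ?thesis
    using rec_env_primrec[OF rec_env_const[of 0] _ assms(1),
        of "\<lambda>r i e. if P r e then r else Suc r"]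
    by (simp add: rec_env_if rec_env_Suc rec_env_var dec_env_skip[OF assms(2)])
qed

lemma dec_env_bex [rec_env_intros]:
  assumes "rec_env B" "dec_env (\<lambda>e. P (e 0) (\<lambda>i. e (Suc i)))"
  shows "dec_env (\<lambda>e. \<exists>i<B e. P i e)"
  using dec_env_less[OF rec_env_bounded_least[OF assms] assms(1)]
  by (simp add: bounded_least_less_iff)

lemma rec_env_div [rec_env_intros]:
  assumes "rec_env F" "rec_env G" shows "rec_env (\<lambda>e. F e div G e)"
proof -
  have "a div b = (if b = 0 then 0 else bounded_least (\<lambda>q. a < Suc q * b) (Suc a))" for a b :: nat
  proof (cases "b = 0")
    case False
    have "bounded_least (\<lambda>q. a < Suc q * b) (Suc a) = a div b"
    proof (rule bounded_least_eqI)
      show "a < Suc (a div b) * b"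
        using False dividend_less_div_times[of b a] by (simp add: add.commute)
      show "\<not> a < Suc m * b" if "m < a div b" for m
        using that False less_eq_div_iff_mult_less_eq[of b "Suc m" a] by simp
    qed (simp add: less_Suc_eq_le)
    then show ?thesis using False by simp
  qed simp
  then show ?thesis
    by (simp only:) (intro rec_env_intros assms assms[THEN rec_env_shift])
qed

lemma rec_env_mod [rec_env_intros]:
  assumes "rec_env F" "rec_env G" shows "rec_env (\<lambda>e. F e mod G e)"
  using rec_env_diff[OF assms(1) rec_env_mult[OF rec_env_div[OF assms] assms(2)]]
  by (simp add: minus_div_mult_eq_mod)

section \<open>Step-bounded evaluation\<close>

text \<open>A partial function on lists is represented by a total one: the value \<open>0\<close> means that no result
  has been found, and \<open>Suc y\<close> that the result is \<open>y\<close>.\<close>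

definition on_results :: "(nat list \<Rightarrow> nat) \<Rightarrow> nat list \<Rightarrow> nat" where
  "on_results F ys = (if 0 \<in> set ys then 0 else F (map (\<lambda>y. y - 1) ys))"

primrec prim_iterate :: "(nat list \<Rightarrow> nat) \<Rightarrow> (nat list \<Rightarrow> nat) \<Rightarrow> nat list \<Rightarrow> nat \<Rightarrow> nat" where
  "prim_iterate F G xs 0 = F xs"
| "prim_iterate F G xs (Suc n) =
    (let r = prim_iterate F G xs n in if r = 0 then 0 else G ((r - 1) # n # xs))"

definition bounded_search :: "nat \<Rightarrow> (nat list \<Rightarrow> nat) \<Rightarrow> nat list \<Rightarrow> nat" where
  "bounded_search t F xs =
    (let n = bounded_least (\<lambda>n. F (n # xs) \<le> 1) t
     in if n < t \<and> F (n # xs) = 1 then Suc n else 0)"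

fun eval_within :: "recf \<Rightarrow> nat \<Rightarrow> nat list \<Rightarrow> nat" where
  "eval_within Zero t xs = 1"
| "eval_within Succ t xs = (case xs of [] \<Rightarrow> 0 | x # _ \<Rightarrow> Suc (Suc x))"
| "eval_within (Proj i) t xs = (if i < length xs then Suc (xs ! i) else 0)"
| "eval_within (Comp f gs) t xs = on_results (eval_within f t) (map (\<lambda>g. eval_within g t xs) gs)"
| "eval_within (Prim f g) t xs =
    (case xs of [] \<Rightarrow> 0 | n # xs' \<Rightarrow> prim_iterate (eval_within f t) (eval_within g t) xs' n)"
| "eval_within (Mn f) t xs = bounded_search t (eval_within f t) xs"

lemma on_results_eq_Suc_iff:
  "on_results F ys = Suc y \<longleftrightarrow> (\<exists>zs. ys = map Suc zs \<and> F zs = Suc y)"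
proof
  assume "on_results F ys = Suc y"
  then have "0 \<notin> set ys" "F (map (\<lambda>y. y - 1) ys) = Suc y"
    by (auto simp: on_results_def split: if_splits)
  moreover from this have "ys = map Suc (map (\<lambda>y. y - 1) ys)"
    by (auto intro!: map_idI[symmetric] simp: comp_def) (metis Suc_pred not_gr_zero)
  ultimately show "\<exists>zs. ys = map Suc zs \<and> F zs = Suc y" by blast
qed (auto simp: on_results_def comp_def)

lemma prim_iterate_Suc_eq_Suc_iff:
  "prim_iterate F G xs (Suc n) = Suc y \<longleftrightarrow>
    (\<exists>z. prim_iterate F G xs n = Suc z \<and> G (z # n # xs) = Suc y)"
  by (cases "prim_iterate F G xs n") auto

declare prim_iterate.simps(2) [simp del]

lemma bounded_search_eq_Suc_iff:
  "bounded_search t F xs = Suc y \<longleftrightarrow>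
    y < t \<and> F (y # xs) = 1 \<and> (\<forall>m<y. 1 < F (m # xs))"
proof
  assume "bounded_search t F xs = Suc y"
  then have "y < t" "F (y # xs) = 1" "y = bounded_least (\<lambda>n. F (n # xs) \<le> 1) t"
    by (auto simp: bounded_search_def Let_def split: if_splits)
  moreover from this(3) have "1 < F (m # xs)" if "m < y" for m
    using not_less_bounded_least[of m "\<lambda>n. F (n # xs) \<le> 1" t] that by simp
  ultimately show "y < t \<and> F (y # xs) = 1 \<and> (\<forall>m<y. 1 < F (m # xs))" by blast
next
  assume least_y: "y < t \<and> F (y # xs) = 1 \<and> (\<forall>m<y. 1 < F (m # xs))"
  then have "bounded_least (\<lambda>n. F (n # xs) \<le> 1) t = y"
    by (intro bounded_least_eqI) (auto simp: not_le)
  with least_y show "bounded_search t F xs = Suc y" by (simp add: bounded_search_def)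
qed

lemma prim_iterate_sound:
  assumes "\<And>xs y. F xs = Suc y \<Longrightarrow> eval_recf f xs y" "\<And>xs y. G xs = Suc y \<Longrightarrow> eval_recf g xs y"
  shows "prim_iterate F G xs n = Suc y \<Longrightarrow> eval_recf (Prim f g) (n # xs) y"
proof (induction n arbitrary: y)
  case 0
  then show ?case using assms(1) by (simp add: eval_Prim_0)
next
  case (Suc n)
  then show ?case using assms(2) by (auto simp: eval_Prim_Suc prim_iterate_Suc_eq_Suc_iff)
qed

lemma eval_within_sound: "eval_within f t xs = Suc y \<Longrightarrow> eval_recf f xs y"
proof (induction f arbitrary: xs y)
  case (Comp f gs)
  then obtain zs where results: "map (\<lambda>g. eval_within g t xs) gs = map Suc zs"
    "eval_within f t zs = Suc y"
    by (auto simp: on_results_eq_Suc_iff)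
  then have "list_all2 (\<lambda>g z. eval_recf g xs z) gs zs"
    using Comp.IH(2) by (auto simp: list_all2_conv_all_nth list_eq_iff_nth_eq)
  then show ?case using Comp.IH(1) results(2) by (auto simp: eval_Comp)
next
  case (Prim f g)
  then obtain n xs' where "xs = n # xs'" by (cases xs) auto
  then show ?case
    using prim_iterate_sound[OF Prim.IH] Prim.prems by simp
next
  case (Mn f)
  then have "eval_within f t (y # xs) = Suc 0" and pos: "\<forall>m<y. 1 < eval_within f t (m # xs)"
    by (auto simp: bounded_search_eq_Suc_iff)
  moreover have "\<exists>z. eval_recf f (m # xs) z \<and> z \<noteq> 0" if "m < y" for m
  proof -
    have "eval_within f t (m # xs) = Suc (eval_within f t (m # xs) - 1)"
      "eval_within f t (m # xs) - 1 \<noteq> 0"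
      using pos that by auto
    then show ?thesis using Mn.IH by blast
  qed
  ultimately show ?case using Mn.IH by (auto simp: eval_Mn)
qed (auto simp: eval_Zero eval_Succ eval_Proj split: list.splits if_splits)

lemma eval_within_complete:
  "eval_recf f xs y \<Longrightarrow> eventually (\<lambda>t. eval_within f t xs = Suc y) sequentially"
proof (induction rule: eval_recf.induct)
  case (ev_comp xs gs ys f z)
  have "eventually (\<lambda>t. \<forall>i\<in>{..<length gs}. eval_within (gs ! i) t xs = Suc (ys ! i)) sequentially"
    using ev_comp.IH(1) by (intro eventually_ball_finite) (auto simp: list_all2_conv_all_nth)
  then show ?case using ev_comp.IH(2)
  proof eventually_elim
    case (elim t)
    have "map (\<lambda>g. eval_within g t xs) gs = map Suc ys"
      using elim(1) ev_comp.IH(1) by (auto simp: list_all2_conv_all_nth intro!: nth_equalityI)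
    then show ?case using elim(2) by (auto simp: on_results_eq_Suc_iff)
  qed
next
  case (ev_primS f g n xs y z)
  from ev_primS.IH show ?case
    by eventually_elim (simp add: prim_iterate_Suc_eq_Suc_iff)
next
  case (ev_mn f n xs)
  have "eventually (\<lambda>t. \<forall>m\<in>{..<n}. 1 < eval_within f t (m # xs)) sequentially"
  proof (intro eventually_ball_finite ballI)
    fix m assume "m \<in> {..<n}"
    then obtain y where "eventually (\<lambda>t. eval_within f t (m # xs) = Suc y) sequentially" "y \<noteq> 0"
      using ev_mn.IH(2) by auto
    then show "eventually (\<lambda>t. 1 < eval_within f t (m # xs)) sequentially"
      by (auto elim: eventually_mono)
  qed simp
  then show ?case using ev_mn.IH(1) eventually_gt_at_top[of n]
    by eventually_elim (auto simp: bounded_search_eq_Suc_iff)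
qed simp_all

definition recursive_lists :: "(nat \<Rightarrow> nat list \<Rightarrow> nat) \<Rightarrow> bool" where
  "recursive_lists S \<longleftrightarrow> (\<forall>T Gs. rec_env T \<longrightarrow> (\<forall>G\<in>set Gs. rec_env G) \<longrightarrow>
    rec_env (\<lambda>e. S (T e) (map (\<lambda>G. G e) Gs)))"

lemma recursive_listsD:
  "recursive_lists S \<Longrightarrow> rec_env T \<Longrightarrow> (\<And>G. G \<in> set Gs \<Longrightarrow> rec_env G) \<Longrightarrow>
    rec_env (\<lambda>e. S (T e) (map (\<lambda>G. G e) Gs))"
  by (simp add: recursive_lists_def)

lemma recursive_lists_on_results:
  assumes rec_F: "recursive_lists F" and rec_Ss: "\<And>S. S \<in> set Ss \<Longrightarrow> recursive_lists S"
  shows "recursive_lists (\<lambda>t xs. on_results (F t) (map (\<lambda>S. S t xs) Ss))"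
  unfolding recursive_lists_def
proof (intro allI impI)
  fix T Gs assume rec_T: "rec_env T" and rec_Gs: "\<forall>G\<in>set Gs. rec_env G"
  define Hs where "Hs = map (\<lambda>S e. S (T e) (map (\<lambda>G. G e) Gs)) Ss"
  have "rec_env (\<lambda>e. S (T e) (map (\<lambda>G. G e) Gs))" if "S \<in> set Ss" for S
    using recursive_listsD[OF rec_Ss[OF that] rec_T] rec_Gs by blast
  then have rec_Hs: "\<forall>H\<in>set Hs. rec_env H" by (auto simp: Hs_def)
  have "dec_env (\<lambda>e. 0 \<notin> set (map (\<lambda>H. H e) Hs'))" if "\<forall>H\<in>set Hs'. rec_env H" for Hs'
    using that
  proof (induction Hs')
    case Nil
    then show ?case by (simp add: dec_env_def rec_env_const)
  next
    case (Cons H Hs')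
    then show ?case by (simp add: dec_env_conj dec_env_not[OF dec_env_eq_0] del: neq0_conv)
  qed
  then have "dec_env (\<lambda>e. 0 \<notin> set (map (\<lambda>H. H e) Hs))" using rec_Hs by blast
  moreover have "rec_env (\<lambda>e. H e - 1)" if "H \<in> set Hs" for H
    by (intro rec_env_intros bspec[OF rec_Hs that])
  then have "rec_env (\<lambda>e. F (T e) (map (\<lambda>H. H e) (map (\<lambda>H e. H e - 1) Hs)))"
    by (intro recursive_listsD[OF rec_F rec_T]) auto
  ultimately have "rec_env (\<lambda>e. if 0 \<notin> set (map (\<lambda>H. H e) Hs)
      then F (T e) (map (\<lambda>H. H e) (map (\<lambda>H e. H e - 1) Hs)) else 0)"
    by (intro rec_env_if rec_env_const)
  moreover have "(if 0 \<notin> set (map (\<lambda>H. H e) Hs)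
      then F (T e) (map (\<lambda>H. H e) (map (\<lambda>H e. H e - 1) Hs)) else 0) =
      on_results (F (T e)) (map (\<lambda>S. S (T e) (map (\<lambda>G. G e) Gs)) Ss)" for e
    by (simp add: on_results_def Hs_def comp_def image_image)
  ultimately show "rec_env (\<lambda>e. on_results (F (T e)) (map (\<lambda>S. S (T e) (map (\<lambda>G. G e) Gs)) Ss))"
    by (simp only:)
qed

lemma recursive_lists_prim_iterate:
  assumes rec_F: "recursive_lists F" and rec_S: "recursive_lists S"
  shows "recursive_lists
    (\<lambda>t xs. case xs of [] \<Rightarrow> 0 | n # xs' \<Rightarrow> prim_iterate (F t) (S t) xs' n)"
  unfolding recursive_lists_def
proof (intro allI impI)
  fix T Gs assume rec_T: "rec_env T" and rec_Gs: "\<forall>G\<in>set Gs. rec_env G"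
  show "rec_env (\<lambda>e. case map (\<lambda>G. G e) Gs of [] \<Rightarrow> 0
      | n # xs' \<Rightarrow> prim_iterate (F (T e)) (S (T e)) xs' n)"
  proof (cases Gs)
    case Nil
    then show ?thesis by (simp add: rec_env_const)
  next
    case (Cons N Gs')
    have iterate_eq: "prim_iterate F G xs n =
        rec_nat (F xs) (\<lambda>i r. if r = 0 then 0 else G ((r - 1) # i # xs)) n" for F G xs n
      by (induction n) (simp_all add: prim_iterate.simps Let_def)
    have "rec_env (\<lambda>e. S (T (\<lambda>i. e (Suc (Suc i)))) (map (\<lambda>G. G e)
        ((\<lambda>e. e 0 - 1) # (\<lambda>e. e (Suc 0)) # map (\<lambda>G e. G (\<lambda>i. e (Suc (Suc i)))) Gs')))"
      using rec_Gs Cons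
      by (intro recursive_listsD[OF rec_S rec_T[THEN rec_env_shift, THEN rec_env_shift]])
         (auto simp: rec_env_diff rec_env_const rec_env_var rec_env_shift[OF rec_env_shift])
    then have "rec_env (\<lambda>e. if e 0 = 0 then 0 else S (T (\<lambda>i. e (Suc (Suc i))))
        ((e 0 - 1) # e (Suc 0) # map (\<lambda>G. G (\<lambda>i. e (Suc (Suc i)))) Gs'))"
      by (intro rec_env_intros) (simp add: comp_def)
    moreover have "rec_env (\<lambda>e. F (T e) (map (\<lambda>G. G e) Gs'))"
      using rec_Gs Cons by (intro recursive_listsD[OF rec_F rec_T]) auto
    ultimately show ?thesis
      using Cons rec_Gs rec_env_primrec[where h = "\<lambda>r i e. if r = 0 then 0 else
          S (T e) ((r - 1) # i # map (\<lambda>G. G e) Gs')"]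
      by (simp add: iterate_eq)
  qed
qed

lemma recursive_lists_bounded_search:
  assumes "recursive_lists S"
  shows "recursive_lists (\<lambda>t. bounded_search t (S t))"
  unfolding recursive_lists_def
proof (intro allI impI)
  fix T Gs assume rec_T: "rec_env T" and rec_Gs: "\<forall>G\<in>set Gs. rec_env G"
  define n where "n e = bounded_least (\<lambda>n. S (T e) (n # map (\<lambda>G. G e) Gs) \<le> 1) (T e)" for e
  have "rec_env (\<lambda>e. S (T (\<lambda>i. e (Suc i)))
      (map (\<lambda>G. G e) ((\<lambda>e. e 0) # map (\<lambda>G e. G (\<lambda>i. e (Suc i))) Gs)))"
    using rec_Gs by (intro recursive_listsD[OF assms rec_T[THEN rec_env_shift]])
      (auto simp: rec_env_var rec_env_shift)
  then have "rec_env n"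
    unfolding n_def by (intro rec_env_intros rec_T) (simp add: comp_def)
  moreover from this have "rec_env (\<lambda>e. S (T e) (map (\<lambda>G. G e) (n # Gs)))"
    using rec_Gs by (intro recursive_listsD[OF assms rec_T]) auto
  ultimately have "rec_env (\<lambda>e. if n e < T e \<and> S (T e) (n e # map (\<lambda>G. G e) Gs) = 1
      then Suc (n e) else 0)"
    by (intro rec_env_intros rec_T) simp_all
  then show "rec_env (\<lambda>e. bounded_search (T e) (S (T e)) (map (\<lambda>G. G e) Gs))"
    unfolding bounded_search_def n_def Let_def .
qed

lemma recursive_lists_eval_within: "recursive_lists (eval_within f)"
proof (induction f)
  case Zero
  then show ?case by (simp add: recursive_lists_def rec_env_const)
next
  case Succ
  have "rec_env (\<lambda>e. case map (\<lambda>G. G e) Gs of [] \<Rightarrow> 0 | x # _ \<Rightarrow> Suc (Suc x))"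
    if "\<forall>G\<in>set Gs. rec_env G" for Gs
    using that by (cases Gs) (simp_all add: rec_env_const rec_env_Suc)
  then show ?case by (simp add: recursive_lists_def)
next
  case (Proj i)
  have "rec_env (\<lambda>e. if i < length Gs then Suc (map (\<lambda>G. G e) Gs ! i) else 0)"
    if "\<forall>G\<in>set Gs. rec_env G" for Gs
    using that by (cases "i < length Gs") (simp_all add: rec_env_const rec_env_Suc)
  then show ?case by (simp add: recursive_lists_def)
next
  case (Comp f gs)
  then show ?case
    using recursive_lists_on_results[of "eval_within f" "map eval_within gs"]
    by (auto simp: comp_def)
next
  case (Prim f g)
  then show ?case using recursive_lists_prim_iterate by simp
next
  case (Mn f)
  then show ?case using recursive_lists_bounded_search by simp
qed

lemma rec_env_at_list:
  assumes "rec_env F"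
  shows "\<exists>r. \<forall>xs y. length xs = n \<longrightarrow>
    (eval_recf r xs y \<longleftrightarrow> y = F (\<lambda>i. if i < n then xs ! i else 0))"
proof -
  obtain r k where eval_r: "\<forall>k'\<ge>k. \<forall>e y. eval_recf r (map e [0..<k']) y \<longleftrightarrow> y = F e"
    using assms unfolding rec_env_def by blast
  have "eval_recf (Comp r (map (\<lambda>i. if i < n then Proj i else Zero) [0..<k])) xs y
      \<longleftrightarrow> y = F (\<lambda>i. if i < n then xs ! i else 0)" if "length xs = n" for xs y
    unfolding eval_Comp
    by (subst list_all2_eval_map[where v = "\<lambda>i. if i < n then xs ! i else 0"])
       (auto simp: eval_Proj eval_Zero that eval_r)
  then show ?thesis by blast
qed

lemma recursive2_eval:
  assumes "recursive2 f"
  obtains r where "\<And>a b y. eval_recf r [a, b] y \<longleftrightarrow> y = f a b"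
proof -
  obtain r where eval_r: "\<forall>xs y. length xs = 2 \<longrightarrow> (eval_recf r xs y \<longleftrightarrow>
      y = f (if (0::nat) < 2 then xs ! 0 else 0) (if Suc 0 < 2 then xs ! Suc 0 else 0))"
    using rec_env_at_list[OF assms[unfolded recursive2_def], of 2] by blast
  show ?thesis
    by (rule that[of r]) (simp add: eval_r)
qed

lemma partial_recursive_search:
  assumes decidable_R: "decidable2 R" and recursive_h: "recursive2 h"
  shows "partial_recursive (\<lambda>x. if \<exists>z. R x z then Some (h x (LEAST z. R x z)) else None)"
proof -
  have "recursive2 (\<lambda>z x. if \<not> R x z then 1 else 0)"
    unfolding recursive2_def
    by (intro rec_env_intros dec_env_decidable2[OF decidable_R])
  then obtain r where eval_r: "\<And>z x y. eval_recf r [z, x] y \<longleftrightarrow> y = (if \<not> R x z then 1 else 0)"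
    by (rule recursive2_eval) blast
  obtain s where eval_s: "\<And>x z y. eval_recf s [x, z] y \<longleftrightarrow> y = h x z"
    using recursive2_eval[OF recursive_h] by blast
  have search: "eval_recf (Mn r) [x] z \<longleftrightarrow> R x z \<and> (\<forall>m<z. \<not> R x m)" for x z
    by (auto simp: eval_Mn eval_r)
  have least: "R x z \<and> (\<forall>m<z. \<not> R x m) \<longleftrightarrow> (\<exists>z. R x z) \<and> z = (LEAST z. R x z)" for x z
    by (metis LeastI not_less_Least linorder_neqE_nat)
  have "eval_recf (Comp s [Proj 0, Mn r]) [x] y \<longleftrightarrow>
      (if \<exists>z. R x z then Some (h x (LEAST z. R x z)) else None) = Some y" for x y
    by (auto simp: eval_Comp list_all2_Cons1 search least eval_Proj eval_s)
  then show ?thesis unfolding partial_recursive_def by blast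
qed

section \<open>Binary strings and their codes\<close>

lemma Suc_str_code: "Suc (str_code s) =
    (\<Sum>i<length s. (if s ! i then 1 else 0) * 2 ^ (length s - 1 - i)) + 2 ^ length s"
  by (simp add: str_code_def Suc_diff_1)

lemma str_code_Nil [simp]: "str_code [] = 0"
  by (simp add: str_code_def)

lemma Suc_str_code_snoc:
  "Suc (str_code (s @ [b])) = 2 * Suc (str_code s) + (if b then 1 else 0)"
proof -
  have "(\<Sum>i<length s. (if (s @ [b]) ! i then 1 else 0) * 2 ^ (length s - i)) =
      (\<Sum>i<length s. 2 * ((if s ! i then 1 else 0) * 2 ^ (length s - 1 - i)) :: nat)"
  proof (rule sum.cong[OF refl])
    fix i assume "i \<in> {..<length s}"
    then have "length s - i = Suc (length s - 1 - i)" "i < length s" by auto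
    then show "(if (s @ [b]) ! i then 1 else 0) * 2 ^ (length s - i) =
        2 * ((if s ! i then 1 else 0) * 2 ^ (length s - 1 - i) :: nat)"
      by (simp only: nth_append) simp
  qed
  then show ?thesis
    unfolding Suc_str_code by (simp add: sum_distrib_left)
qed

lemma str_code_bounds: "2 ^ length s \<le> Suc (str_code s)" "Suc (str_code s) < 2 ^ Suc (length s)"
proof -
  have "2 ^ length s \<le> Suc (str_code s) \<and> Suc (str_code s) < 2 ^ Suc (length s)"
  proof (induction s rule: rev_induct)
    case (snoc b s)
    then show ?case by (simp only: Suc_str_code_snoc) auto
  qed simp
  then show "2 ^ length s \<le> Suc (str_code s)" "Suc (str_code s) < 2 ^ Suc (length s)" by auto
qed

lemma inj_str_code: "inj str_code"
proof (rule injI)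
  show "s = t" if "str_code s = str_code t" for s t
    using that
  proof (induction s arbitrary: t rule: rev_induct)
    case Nil
    show ?case
    proof (cases t rule: rev_cases)
      case (snoc u c)
      then show ?thesis using Nil Suc_str_code_snoc[of u c] by simp
    qed simp
  next
    case (snoc b s)
    then have "t \<noteq> []"
      using Suc_str_code_snoc[of s b] by auto
    then obtain u c where t_eq: "t = u @ [c]" by (cases t rule: rev_cases) auto
    have code_eq: "2 * Suc (str_code s) + (if b then 1 else 0) =
        2 * Suc (str_code u) + (if c then 1 else 0)"
      using snoc.prems t_eq Suc_str_code_snoc[of s b] Suc_str_code_snoc[of u c] by simp
    then have "b = c" by (cases b; cases c; simp; presburger)
    with code_eq have "str_code s = str_code u" by simp
    with snoc.IH \<open>b = c\<close> t_eq show ?case by simp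
  qed
qed

lemma surj_str_code: "surj str_code"
proof -
  have "\<exists>s. str_code s = c" for c
  proof (induction c rule: less_induct)
    case (less c)
    show ?case
    proof (cases "c = 0")
      case True
      then show ?thesis using str_code_Nil by blast
    next
      case False
      then have "Suc c div 2 - 1 < c" by presburger
      then obtain s where code_s: "str_code s = Suc c div 2 - 1" using less by blast
      then have "Suc (str_code (s @ [odd (Suc c)])) = Suc c"
        using False unfolding Suc_str_code_snoc code_s
        by (cases "odd (Suc c)") (simp_all, presburger+)
      then show ?thesis by blast
    qed
  qed
  then show ?thesis by (metis surjI)
qed

definition str_decode :: "nat \<Rightarrow> bool list" where
  "str_decode = inv str_code"

abbreviation strlen :: "nat \<Rightarrow> nat" where
  "strlen c \<equiv> length (str_decode c)"

lemma str_decode_code [simp]: "str_decode (str_code s) = s"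
  by (simp add: str_decode_def inj_str_code)

lemma str_code_decode [simp]: "str_code (str_decode c) = c"
  by (simp add: str_decode_def surj_str_code surj_f_inv_f)

lemma strlen_bounds: "2 ^ strlen c \<le> Suc c" "Suc c < 2 ^ Suc (strlen c)"
  using str_code_bounds[of "str_decode c"] by simp_all

lemma strlen_eqI:
  assumes "2 ^ l \<le> Suc c" "Suc c < 2 ^ Suc l"
  shows "strlen c = l"
proof -
  have "(2::nat) ^ l < 2 ^ Suc (strlen c)" "(2::nat) ^ strlen c < 2 ^ Suc l"
    using strlen_bounds[of c] assms by linarith+
  then show ?thesis by (simp only: power_strict_increasing_iff)
qed

lemma strlen_le: "strlen c \<le> c"
  using strlen_bounds(1)[of c] less_exp[of "strlen c"] by linarith

lemma rec_env_strlen [rec_env_intros]: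
  assumes "rec_env F"
  shows "rec_env (\<lambda>e. strlen (F e))"
proof -
  have "strlen c = bounded_least (\<lambda>i. Suc c < 2 ^ Suc i) (Suc c)" for c
  proof (rule bounded_least_eqI[symmetric])
    show "\<not> Suc c < 2 ^ Suc m" if "m < strlen c" for m
      using that strlen_bounds(1)[of c] power_increasing[of "Suc m" "strlen c" "2::nat"] by simp
  qed (use strlen_bounds(2) strlen_le in \<open>simp_all add: less_Suc_eq_le\<close>)
  then show ?thesis
    by (simp only:) (intro rec_env_intros assms assms[THEN rec_env_shift])
qed

lemma Suc_str_code_append:
  "Suc (str_code (s @ x)) = Suc (str_code s) * 2 ^ length x + (Suc (str_code x) - 2 ^ length x)"
proof (induction x rule: rev_induct)
  case (snoc b x)
  have "Suc (str_code (s @ x @ [b])) = 2 * Suc (str_code (s @ x)) + (if b then 1 else 0)"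
    using Suc_str_code_snoc[of "s @ x" b] by simp
  then show ?case using str_code_bounds(1)[of x]
    by (simp only: snoc.IH Suc_str_code_snoc) (simp add: algebra_simps)
qed simp

lemma str_code_replicate_True: "str_code (replicate a True) + 2 = 2 ^ Suc a"
proof (induction a)
  case (Suc a)
  have "replicate (Suc a) True = replicate a True @ [True]"
    by (simp add: replicate_append_same)
  then show ?case using Suc Suc_str_code_snoc[of "replicate a True" True] by simp
qed simp

lemma length_prefix_bits [simp]: "length (prefix_bits x n) = n"
  by (simp add: prefix_bits_def)

lemma nat_floor_double:
  fixes y :: real
  assumes "0 \<le> y"
  shows "nat \<lfloor>2 * y\<rfloor> = 2 * nat \<lfloor>y\<rfloor> + (if odd \<lfloor>2 * y\<rfloor> then 1 else 0)"
proof -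
  have "nat m = 2 * nat (m div 2) + (if odd m then 1 else 0)" if "0 \<le> m" for m
    using that by (cases "odd m") (simp_all add: nat_div_distrib flip: even_nat_iff)
  moreover have "\<lfloor>2 * y\<rfloor> div 2 = \<lfloor>y\<rfloor>"
    using floor_divide_real_eq_div[of 2 "2 * y"] by simp
  ultimately show ?thesis using assms by (metis zero_le_floor zero_le_mult_iff zero_le_numeral)
qed

lemma Suc_str_code_prefix_bits:
  "Suc (str_code (prefix_bits x n)) = 2 ^ n + nat \<lfloor>2 ^ n * frac x\<rfloor>"
proof (induction n)
  case 0
  have "\<lfloor>frac x\<rfloor> = 0" by (simp add: floor_eq_iff frac_lt_1)
  then show ?case by (simp add: prefix_bits_def)
next
  case (Suc n)
  have "prefix_bits x (Suc n) = prefix_bits x n @ [odd \<lfloor>2 * (2 ^ n * frac x)\<rfloor>]"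
    by (simp add: prefix_bits_def mult.assoc)
  moreover have "nat \<lfloor>2 ^ Suc n * frac x\<rfloor> =
      2 * nat \<lfloor>2 ^ n * frac x\<rfloor> + (if odd \<lfloor>2 * (2 ^ n * frac x)\<rfloor> then 1 else 0)"
    using nat_floor_double[of "2 ^ n * frac x"] by (simp add: mult.assoc)
  ultimately show ?case by (simp only: Suc_str_code_snoc Suc) simp
qed

section \<open>Prefix-free machines\<close>

lemma prefix_free_subset: "B \<subseteq> A \<Longrightarrow> prefix_free A \<Longrightarrow> prefix_free B"
  unfolding prefix_free_def by (meson subsetD)

lemma card_prefix_extensions:
  assumes "length p \<le> n"
  shows "card {x :: bool list. length x = n \<and> prefix p x} = 2 ^ (n - length p)"
proof -
  have "{x. length x = n \<and> prefix p x} = (@) p ` {y. length y = n - length p}"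
    using assms by (auto simp: prefix_def)
  moreover have "card {y :: bool list. length y = n - length p} = 2 ^ (n - length p)"
    using card_lists_length_eq[of "UNIV :: bool set"] by simp
  ultimately show ?thesis by (simp add: card_image inj_on_def)
qed

lemma kraft_inequality:
  assumes "finite B" "prefix_free B"
  shows "(\<Sum>p\<in>B. (1/2 :: real) ^ length p) \<le> 1"
proof -
  obtain n where length_le: "\<And>p. p \<in> B \<Longrightarrow> length p \<le> n"
    using finite_nat_set_iff_bounded_le[of "length ` B"] assms(1) by auto
  define E where "E p = {x. length x = n \<and> prefix p x}" for p :: "bool list"
  have fin: "finite {x :: bool list. length x = n}"
    using finite_lists_length_eq[of "UNIV :: bool set"] by simp
  have "E p \<inter> E q = {}" if "p \<in> B" "q \<in> B" "p \<noteq> q" for p q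
    using assms(2) that prefix_same_cases unfolding prefix_free_def E_def by blast
  then have "(\<Sum>p\<in>B. 2 ^ (n - length p)) = card (\<Union>p\<in>B. E p)"
    using assms(1) length_le fin
    by (subst card_UN_disjoint) (auto simp: E_def card_prefix_extensions)
  also have "\<dots> \<le> card {x :: bool list. length x = n}"
    by (intro card_mono fin) (auto simp: E_def)
  also have "\<dots> = 2 ^ n"
    using card_lists_length_eq[of "UNIV :: bool set"] by simp
  finally have "(\<Sum>p\<in>B. 2 ^ (n - length p)) \<le> (2 ^ n :: real)"
    by (metis (mono_tags, lifting) of_nat_le_iff of_nat_numeral of_nat_power of_nat_sum sum.cong)
  moreover have "(2 :: real) ^ (n - length p) = 2 ^ n * (1/2) ^ length p" if "p \<in> B" for p
    using length_le[OF that] by (simp add: power_diff power_one_over)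
  ultimately have "2 ^ n * (\<Sum>p\<in>B. (1/2 :: real) ^ length p) \<le> 2 ^ n * 1"
    by (simp add: sum_distrib_left)
  then show ?thesis by (simp only: mult_le_cancel_left_pos zero_less_power zero_less_numeral)
qed

lemma Hc_le_iff: "Hc V s \<le> enat n \<longleftrightarrow> (\<exists>p. V p = Some s \<and> length p \<le> n)"
proof -
  have "Hc V s \<le> enat n \<longleftrightarrow> Hc V s < enat (Suc n)"
    by (cases "Hc V s") auto
  then show ?thesis
    unfolding Hc_def by (auto simp: INF_less_iff less_Suc_eq_le)
qed

lemma Hc_eq_enat_imp:
  assumes "Hc V s = enat n"
  shows "\<exists>p. V p = Some s \<and> length p = n"
proof -
  obtain p where program: "V p = Some s" "length p \<le> n"
    using assms Hc_le_iff[of V s n] by auto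
  moreover have "n \<le> length p"
    using assms program(1) Hc_le_iff[of V s "length p"] by auto
  ultimately show ?thesis by auto
qed

definition compressible_strings :: "(bool list \<Rightarrow> bool list option) \<Rightarrow> bool list set" where
  "compressible_strings V = {s. Hc V s < enat (length s)}"

lemma compressible_strings_iff:
  "s \<in> compressible_strings V \<longleftrightarrow> (\<exists>p. V p = Some s \<and> length p < length s)"
  unfolding compressible_strings_def Hc_def by (auto simp: INF_less_iff)

lemma kraft_compressible_strings:
  assumes machine_V: "prefix_free_machine V"
    and compressible_F: "finite F" "F \<subseteq> compressible_strings V"
  shows "(\<Sum>s\<in>F. (1/2 :: real) ^ length s) \<le> 1/2"
proof -
  obtain P where programs: "\<And>s. s \<in> F \<Longrightarrow> V (P s) = Some s \<and> length (P s) < length s"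
    using compressible_F(2) unfolding compressible_strings_iff subset_iff by metis
  then have inj: "inj_on P F"
    by (metis inj_onI option.inject)
  have "P ` F \<subseteq> dom V" using programs by blast
  then have "prefix_free (P ` F)"
    using machine_V prefix_free_subset by (simp add: prefix_free_machine_def)
  then have "(\<Sum>p\<in>P ` F. (1/2 :: real) ^ length p) \<le> 1"
    using compressible_F(1) by (intro kraft_inequality) auto
  then have kraft: "(\<Sum>s\<in>F. (1/2 :: real) ^ length (P s)) \<le> 1"
    using inj by (simp add: sum.reindex)
  have "(1/2 :: real) ^ length s \<le> (1/2) ^ Suc (length (P s))" if "s \<in> F" for s
    using programs[OF that] by (intro power_decreasing) auto
  then have "(\<Sum>s\<in>F. (1/2 :: real) ^ length s) \<le> (\<Sum>s\<in>F. (1/2) ^ Suc (length (P s)))"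
    by (rule sum_mono)
  also have "\<dots> = 1/2 * (\<Sum>s\<in>F. (1/2) ^ length (P s))" by (simp add: sum_distrib_left)
  finally show ?thesis using kraft by linarith
qed

lemma partial_recursive_str_stages:
  assumes "partial_recursive_str C"
  obtains S where "recursive2 S"
    and "\<And>p s. C p = Some s \<Longrightarrow>
      eventually (\<lambda>t. S t (str_code p) = Suc (str_code s)) sequentially"
    and "\<And>t c x. S t c = Suc x \<Longrightarrow> C (str_decode c) = Some (str_decode x)"
proof -
  obtain \<phi> f where eval_f: "\<And>x y. eval_recf f [x] y \<longleftrightarrow> \<phi> x = Some y"
    and phi_code: "\<And>p. \<phi> (str_code p) = map_option str_code (C p)"
    using assms unfolding partial_recursive_str_def partial_recursive_def by blast
  show ?thesis
  proof (rule that[of "\<lambda>t c. eval_within f t [c]"])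
    show "recursive2 (\<lambda>t c. eval_within f t [c])"
      using recursive_listsD[OF recursive_lists_eval_within, of "\<lambda>e. e 0" "[\<lambda>e. e (Suc 0)]" f]
      by (simp add: recursive2_def rec_env_var)
    show "eventually (\<lambda>t. eval_within f t [str_code p] = Suc (str_code s)) sequentially"
      if "C p = Some s" for p s
      using that by (intro eval_within_complete) (simp add: eval_f phi_code)
    show "C (str_decode c) = Some (str_decode x)" if "eval_within f t [c] = Suc x" for c t x
      using eval_within_sound[OF that] phi_code[of "str_decode c"]
      by (cases "C (str_decode c)") (auto simp: eval_f)
  qed
qed

lemma compressible_strings_enumerable:
  assumes "prefix_free_machine V"
  obtains A where "decidable2 (\<lambda>k c. c \<in> A k)" and "\<And>k. A k \<subseteq> {..<k}" and "mono A"
    and "(\<Union>k. A k) = str_code ` compressible_strings V"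
proof -
  have "partial_recursive_str V" using assms by (simp add: prefix_free_machine_def)
  then obtain S where rec: "recursive2 S"
    and complete: "\<And>p s. V p = Some s \<Longrightarrow>
      eventually (\<lambda>t. S t (str_code p) = Suc (str_code s)) sequentially"
    and sound: "\<And>t c x. S t c = Suc x \<Longrightarrow> V (str_decode c) = Some (str_decode x)"
    by (rule partial_recursive_str_stages) blast
  define A where "A k = {c. c < k \<and> (\<exists>p<k. strlen p < strlen c \<and> (\<exists>t<k. S t p = Suc c))}" for k
  have "\<exists>k. str_code s \<in> A k" if short_program: "V p = Some s" "length p < length s" for p s
  proof -
    obtain t where "S t (str_code p) = Suc (str_code s)"
      using complete[OF short_program(1)] by (auto simp: eventually_sequentially)
    then have "str_code s \<in> A (Suc (str_code s + str_code p + t))"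
      using short_program(2) unfolding A_def mem_Collect_eq
      by (intro conjI exI[of _ "str_code p"] exI[of _ t]) auto
    then show ?thesis by blast
  qed
  then have "str_code ` compressible_strings V \<subseteq> (\<Union>k. A k)"
    by (auto simp: compressible_strings_iff)
  moreover have "c \<in> str_code ` compressible_strings V" if "c \<in> A k" for c k
  proof -
    have "str_decode c \<in> compressible_strings V"
      using that sound by (auto simp: A_def compressible_strings_iff)
    then show ?thesis by (metis imageI str_code_decode)
  qed
  ultimately have "(\<Union>k. A k) = str_code ` compressible_strings V" by blast
  moreover have "decidable2 (\<lambda>k c. c \<in> A k)"
    unfolding decidable2_def A_def mem_Collect_eq
    by (intro rec_env_intros rec_env_recursive2[OF rec])
  moreover have "mono A"
    unfolding A_def by (intro monoI) (auto intro: less_le_trans)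
  ultimately show ?thesis using that[of A] by (auto simp: A_def)
qed

lemma partial_recursive_str_decode:
  "partial_recursive \<phi> \<Longrightarrow> partial_recursive_str (\<lambda>p. map_option str_decode (\<phi> (str_code p)))"
  unfolding partial_recursive_str_def
  by (rule exI[of _ \<phi>]) (auto simp: option.map_comp comp_def option.map_ident)

lemma optimal_machine_search:
  assumes optimal_V: "optimal_machine V"
    and decidable_R: "decidable2 R" and recursive_h: "recursive2 h"
    and prefix_free: "prefix_free {p. \<exists>z. R (str_code p) z}"
  shows "\<exists>d. \<forall>p. (\<exists>z. R (str_code p) z) \<longrightarrow>
    Hc V (str_decode (h (str_code p) (LEAST z. R (str_code p) z))) \<le> enat (length p + d)"
proof -
  define \<phi> where "\<phi> c = (if \<exists>z. R c z then Some (h c (LEAST z. R c z)) else None)" for c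
  define C where "C p = map_option str_decode (\<phi> (str_code p))" for p
  have "partial_recursive \<phi>"
    unfolding \<phi>_def by (rule partial_recursive_search[OF decidable_R recursive_h])
  then have "partial_recursive_str C"
    unfolding C_def by (rule partial_recursive_str_decode)
  moreover have dom: "dom C = {p. \<exists>z. R (str_code p) z}"
    by (auto simp: C_def \<phi>_def split: if_splits)
  ultimately have "prefix_free_machine C"
    using prefix_free by (simp add: prefix_free_machine_def)
  then obtain d where simulation:
    "\<And>p. p \<in> dom C \<Longrightarrow> \<exists>q\<in>dom V. V q = C p \<and> length q \<le> length p + d"
    using optimal_V unfolding optimal_machine_def by blast
  have "Hc V (str_decode (h (str_code p) (LEAST z. R (str_code p) z))) \<le> enat (length p + d)"
    if found: "\<exists>z. R (str_code p) z" for p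
  proof -
    obtain q where "V q = C p" "length q \<le> length p + d"
      using simulation[of p] found unfolding dom by blast
    moreover have "C p = Some (str_decode (h (str_code p) (LEAST z. R (str_code p) z)))"
      using found by (simp add: C_def \<phi>_def)
    ultimately show ?thesis unfolding Hc_le_iff by auto
  qed
  then show ?thesis by blast
qed

lemma search_through_machine:
  assumes machine_U: "prefix_free_machine U" and decidable_R: "decidable2 R"
  obtains R' f where "decidable2 R'" and "recursive2 f"
    and "\<And>p z. R' (str_code p) z \<Longrightarrow>
      \<exists>w. U p = Some w \<and> f (str_code p) z = str_code w \<and> R (str_code w) z"
    and "\<And>p w. U p = Some w \<Longrightarrow> eventually (R (str_code w)) sequentially \<Longrightarrow>
      eventually (R' (str_code p)) sequentially"
proof -
  have "partial_recursive_str U" using machine_U by (simp add: prefix_free_machine_def)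
  then obtain S where rec: "recursive2 S"
    and complete: "\<And>p s. U p = Some s \<Longrightarrow>
      eventually (\<lambda>t. S t (str_code p) = Suc (str_code s)) sequentially"
    and sound: "\<And>t c x. S t c = Suc x \<Longrightarrow> U (str_decode c) = Some (str_decode x)"
    by (rule partial_recursive_str_stages) blast
  show ?thesis
  proof (rule that[of "\<lambda>c z. S z c \<noteq> 0 \<and> R (S z c - 1) z" "\<lambda>c z. S z c - 1"])
    show "decidable2 (\<lambda>c z. S z c \<noteq> 0 \<and> R (S z c - 1) z)"
      unfolding decidable2_def
      by (intro rec_env_intros dec_env_decidable2[OF decidable_R] rec_env_recursive2[OF rec])
    show "recursive2 (\<lambda>c z. S z c - 1)"
      unfolding recursive2_def by (intro rec_env_intros rec_env_recursive2[OF rec])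
  next
    fix p z assume "S z (str_code p) \<noteq> 0 \<and> R (S z (str_code p) - 1) z"
    moreover from this obtain x where result: "S z (str_code p) = Suc x"
      by (cases "S z (str_code p)") auto
    ultimately show "\<exists>w. U p = Some w \<and> S z (str_code p) - 1 = str_code w \<and> R (str_code w) z"
      using sound[OF result] by simp
  next
    fix p w assume "U p = Some w" and "eventually (R (str_code w)) sequentially"
    from complete[OF this(1)] this(2)
    show "eventually (\<lambda>z. S z (str_code p) \<noteq> 0 \<and> R (S z (str_code p) - 1) z) sequentially"
      by eventually_elim simp
  qed
qed

lemma optimal_machine_image:
  assumes optimal_V: "optimal_machine V" and machine_U: "prefix_free_machine U"
    and decidable_R: "decidable2 R" and recursive_h: "recursive2 h"
  shows "\<exists>d. \<forall>w. eventually (R (str_code w)) sequentially \<longrightarrow>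
    (\<exists>z. R (str_code w) z \<and> Hc V (str_decode (h (str_code w) z)) \<le> Hc U w + enat d)"
proof -
  obtain R' f where decidable_R': "decidable2 R'" and recursive_f: "recursive2 f"
    and sound: "\<And>p z. R' (str_code p) z \<Longrightarrow>
      \<exists>w. U p = Some w \<and> f (str_code p) z = str_code w \<and> R (str_code w) z"
    and complete: "\<And>p w. U p = Some w \<Longrightarrow> eventually (R (str_code w)) sequentially \<Longrightarrow>
      eventually (R' (str_code p)) sequentially"
    using search_through_machine[OF machine_U decidable_R] by blast
  have "recursive2 (\<lambda>c z. h (f c z) z)"
    unfolding recursive2_def
    by (intro rec_env_intros rec_env_recursive2[OF recursive_h] rec_env_recursive2[OF recursive_f])
  moreover have "prefix_free {p. \<exists>z. R' (str_code p) z}"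
  proof (rule prefix_free_subset)
    show "{p. \<exists>z. R' (str_code p) z} \<subseteq> dom U" using sound by blast
    show "prefix_free (dom U)" using machine_U by (simp add: prefix_free_machine_def)
  qed
  ultimately obtain d where Hc_le: "\<And>p. \<exists>z. R' (str_code p) z \<Longrightarrow>
      Hc V (str_decode (h (f (str_code p) (LEAST z. R' (str_code p) z))
        (LEAST z. R' (str_code p) z))) \<le> enat (length p + d)"
    using optimal_machine_search[OF optimal_V decidable_R', of "\<lambda>c z. h (f c z) z"] by blast
  have "\<exists>z. R (str_code w) z \<and> Hc V (str_decode (h (str_code w) z)) \<le> Hc U w + enat d"
    if eventually_R: "eventually (R (str_code w)) sequentially" for w
  proof (cases "Hc U w")
    case (enat n)
    then obtain p where program: "U p = Some w" "length p = n" using Hc_eq_enat_imp by blast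
    have found: "\<exists>z. R' (str_code p) z"
      using complete[OF program(1) eventually_R] by (auto simp: eventually_sequentially)
    show ?thesis
      using sound[OF LeastI_ex[OF found]] Hc_le[OF found] program enat by auto
  next
    case infinity
    then show ?thesis using eventually_R by (auto simp: eventually_sequentially)
  qed
  then show ?thesis by blast
qed

subsection \<open>Self-delimiting programs\<close>

text \<open>The length \<open>m a\<close> of the binary notation of \<open>N\<close> is announced in unary.\<close>

definition delimited :: "nat \<Rightarrow> nat \<Rightarrow> nat \<Rightarrow> bool list" where
  "delimited m a N = replicate a True @ False # str_decode (2 ^ (m * a) + N - 1)"

context
  fixes m a N :: nat
  assumes N_less: "N < 2 ^ (m * a)"
begin

lemma length_delimited: "length (delimited m a N) = a + 1 + m * a"
  using strlen_eqI[of "m * a" "2 ^ (m * a) + N - 1"] N_less by (simp add: delimited_def)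

lemma Suc_str_code_delimited:
  "Suc (str_code (delimited m a N)) = (2 ^ (a + 2) - 2) * 2 ^ (m * a) + N"
proof -
  define x where "x = str_decode (2 ^ (m * a) + N - 1)"
  have code_x: "Suc (str_code x) = 2 ^ (m * a) + N" by (simp add: x_def)
  have "length x = m * a"
    using length_delimited by (simp add: delimited_def x_def)
  moreover have "delimited m a N = (replicate a True @ [False]) @ x"
    by (simp add: delimited_def x_def)
  moreover have "Suc (str_code (replicate a True @ [False])) = 2 ^ (a + 2) - 2"
    using str_code_replicate_True[of a] by (simp only: Suc_str_code_snoc) simp
  ultimately show ?thesis
    by (simp only: Suc_str_code_append code_x)
qed

end

definition delimited_strings :: "nat \<Rightarrow> bool list set" where
  "delimited_strings m = {delimited m a N | a N. N < 2 ^ (m * a)}"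

lemma prefix_free_delimited_strings: "prefix_free (delimited_strings m)"
  unfolding prefix_free_def
proof (intro ballI impI)
  fix p q assume "p \<in> delimited_strings m" "q \<in> delimited_strings m" and prefix_pq: "prefix p q"
  then obtain a M b N where p_eq: "p = delimited m a M" "M < 2 ^ (m * a)"
    and q_eq: "q = delimited m b N" "N < 2 ^ (m * b)" unfolding delimited_strings_def by blast
  have "i = j" if "prefix (replicate i True @ False # x) (replicate j True @ False # y)"
    for i j and x y :: "bool list"
    using that
  proof (induction i arbitrary: j)
    case 0
    then show ?case by (cases j) auto
  next
    case (Suc i)
    then show ?case by (cases j) auto
  qed
  then have "a = b"
    using prefix_pq unfolding p_eq(1) q_eq(1) delimited_def by blast
  then have "length p = length q"
    using p_eq q_eq by (simp add: length_delimited)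
  then show "p = q"
    using prefix_pq by (auto simp: prefix_def)
qed

definition delimited_header :: "nat \<Rightarrow> nat \<Rightarrow> nat" where
  "delimited_header m c = (strlen c - 1) div Suc m"

definition delimited_payload :: "nat \<Rightarrow> nat \<Rightarrow> nat" where
  "delimited_payload m c = Suc c mod 2 ^ (m * delimited_header m c)"

lemma delimited_header_delimited:
  assumes "N < 2 ^ (m * a)"
  shows "delimited_header m (str_code (delimited m a N)) = a"
proof -
  have "delimited_header m (str_code (delimited m a N)) = a * Suc m div Suc m"
    using assms by (simp add: delimited_header_def length_delimited mult.commute)
  then show ?thesis by (simp only: nonzero_mult_div_cancel_right)
qed

lemma delimited_payload_delimited:
  assumes "N < 2 ^ (m * a)"
  shows "delimited_payload m (str_code (delimited m a N)) = N"
  using assms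
  by (simp add: delimited_payload_def delimited_header_delimited Suc_str_code_delimited)

lemma str_decode_in_delimited_strings_iff:
  "str_decode c \<in> delimited_strings m \<longleftrightarrow>
    Suc c = (2 ^ (delimited_header m c + 2) - 2) * 2 ^ (m * delimited_header m c)
      + delimited_payload m c"
proof
  assume "str_decode c \<in> delimited_strings m"
  then obtain a N where "str_decode c = delimited m a N" and N_bound: "N < 2 ^ (m * a)"
    unfolding delimited_strings_def by blast
  then have "c = str_code (delimited m a N)" by (metis str_code_decode)
  then show "Suc c = (2 ^ (delimited_header m c + 2) - 2) * 2 ^ (m * delimited_header m c)
      + delimited_payload m c"
    using N_bound
    by (simp add: Suc_str_code_delimited delimited_header_delimited delimited_payload_delimited)
next
  define a N where "a = delimited_header m c" and "N = delimited_payload m c"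
  assume "Suc c = (2 ^ (delimited_header m c + 2) - 2) * 2 ^ (m * delimited_header m c)
      + delimited_payload m c"
  moreover have N_bound: "N < 2 ^ (m * a)"
    by (simp add: N_def a_def delimited_payload_def)
  ultimately have "c = str_code (delimited m a N)"
    using Suc_str_code_delimited[OF N_bound] by (simp add: N_def a_def)
  then show "str_decode c \<in> delimited_strings m"
    using N_bound by (auto simp: delimited_strings_def)
qed

lemma rec_env_delimited_header [rec_env_intros]:
  assumes "rec_env F" shows "rec_env (\<lambda>e. delimited_header m (F e))"
  unfolding delimited_header_def by (intro rec_env_intros assms)

lemma rec_env_delimited_payload [rec_env_intros]:
  assumes "rec_env F" shows "rec_env (\<lambda>e. delimited_payload m (F e))"
  unfolding delimited_payload_def by (intro rec_env_intros assms)

lemma dec_env_delimited_strings [rec_env_intros]: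
  assumes "rec_env F" shows "dec_env (\<lambda>e. str_decode (F e) \<in> delimited_strings m)"
  unfolding str_decode_in_delimited_strings_iff by (intro rec_env_intros assms)

lemma optimal_machine_delimited:
  assumes optimal_U: "optimal_machine U"
    and decidable_R: "decidable3 R" and recursive_h: "recursive3 h"
  shows "\<exists>d. \<forall>a N. N < 2 ^ (m * a) \<longrightarrow> (\<exists>z. R a N z) \<longrightarrow>
    Hc U (str_decode (h a N (LEAST z. R a N z))) \<le> enat (a + m * a + d)"
proof -
  define R' where "R' c z \<longleftrightarrow> str_decode c \<in> delimited_strings m \<and>
    R (delimited_header m c) (delimited_payload m c) z" for c z
  have "decidable2 R'"
    unfolding decidable2_def R'_def by (intro rec_env_intros dec_env_decidable3[OF decidable_R])
  moreover have "recursive2 (\<lambda>c. h (delimited_header m c) (delimited_payload m c))"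
    unfolding recursive2_def by (intro rec_env_recursive3[OF recursive_h] rec_env_intros)
  moreover have "prefix_free {p. \<exists>z. R' (str_code p) z}"
    by (rule prefix_free_subset[OF _ prefix_free_delimited_strings[of m]]) (auto simp: R'_def)
  ultimately obtain d where Hc_le: "\<And>p. \<exists>z. R' (str_code p) z \<Longrightarrow>
      Hc U (str_decode (h (delimited_header m (str_code p)) (delimited_payload m (str_code p))
        (LEAST z. R' (str_code p) z))) \<le> enat (length p + d)"
    using optimal_machine_search[OF optimal_U] by blast
  show ?thesis
  proof (intro exI[of _ "Suc d"] allI impI)
    fix a N assume N_bound: "N < 2 ^ (m * a)" and found: "\<exists>z. R a N z"
    have "delimited m a N \<in> delimited_strings m" using N_bound by (auto simp: delimited_strings_def)
    then have "R' (str_code (delimited m a N)) = R a N"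
      using N_bound
      by (simp add: fun_eq_iff R'_def delimited_header_delimited delimited_payload_delimited)
    then show "Hc U (str_decode (h a N (LEAST z. R a N z))) \<le> enat (a + m * a + Suc d)"
      using Hc_le[of "delimited m a N"] N_bound found
      by (simp add: delimited_header_delimited delimited_payload_delimited length_delimited)
  qed
qed

lemma optimal_machine_delimited_finite:
  assumes optimal_U: "optimal_machine U" and decidable_R: "decidable3 R"
    and finite_I: "finite I" and recursive_h: "\<And>i. i \<in> I \<Longrightarrow> recursive3 (h i)"
  shows "\<exists>d. \<forall>i\<in>I. \<forall>a N. N < 2 ^ (m * a) \<longrightarrow> (\<exists>z. R a N z) \<longrightarrow>
    Hc U (str_decode (h i a N (LEAST z. R a N z))) \<le> enat (a + m * a + d)"
proof -
  have "\<forall>i\<in>I. \<exists>d. \<forall>a N. N < 2 ^ (m * a) \<longrightarrow> (\<exists>z. R a N z) \<longrightarrow>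
      Hc U (str_decode (h i a N (LEAST z. R a N z))) \<le> enat (a + m * a + d)"
    using optimal_machine_delimited[OF optimal_U decidable_R recursive_h] by blast
  then obtain d where Hc_le: "\<And>i a N. i \<in> I \<Longrightarrow> N < 2 ^ (m * a) \<Longrightarrow> \<exists>z. R a N z \<Longrightarrow>
      Hc U (str_decode (h i a N (LEAST z. R a N z))) \<le> enat (a + m * a + d i)"
    by metis
  have "enat (a + m * a + d i) \<le> enat (a + m * a + Max (d ` I))" if "i \<in> I" for i a
    using finite_I that by simp
  with Hc_le show ?thesis by (meson order_trans)
qed

lemma compressible_strings_nonempty:
  assumes "optimal_machine V"
  shows "compressible_strings V \<noteq> {}"
proof -
  have "decidable3 (\<lambda>a N z. True)" "recursive3 (\<lambda>a N z. 2 ^ (2 * a) - 1)"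
    unfolding decidable3_def recursive3_def dec_env_def if_True by (intro rec_env_intros)+
  from optimal_machine_delimited[OF assms this, of 0]
  obtain d where "Hc V (str_decode (2 ^ (2 * a) - 1)) \<le> enat (a + d)" for a
    by auto
  then have "Hc V (str_decode (2 ^ (2 * Suc d) - 1)) \<le> enat (Suc d + d)" .
  also have "\<dots> < enat (2 * Suc d)" by simp
  finally have "Hc V (str_decode (2 ^ (2 * Suc d) - 1)) < enat (2 * Suc d)" .
  moreover have "strlen (2 ^ (2 * Suc d) - 1) = 2 * Suc d"
    by (rule strlen_eqI) auto
  ultimately have "str_decode (2 ^ (2 * Suc d) - 1) \<in> compressible_strings V"
    unfolding compressible_strings_def mem_Collect_eq by (simp only:)
  then show ?thesis by blast
qed

section \<open>Approximating the partition function\<close>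

definition weight :: "real \<Rightarrow> nat \<Rightarrow> real" where
  "weight t c = 2 powr (- real (strlen c) / t)"

lemma weight_pos [simp]: "0 < weight t c" and weight_nonneg [simp]: "0 \<le> weight t c"
  by (simp_all add: weight_def)

lemma weight_1: "weight 1 c = (1/2) ^ strlen c"
  by (simp add: weight_def powr_minus powr_realpow power_one_over inverse_eq_divide)

lemma weight_eq_mult: "weight s c = weight t c * 2 powr (- (real (strlen c) * (1 / s - 1 / t)))"
  by (simp add: weight_def right_diff_distrib flip: powr_add)

lemma weight_mono:
  assumes "0 < t" "t \<le> t'"
  shows "weight t c \<le> weight t' c"
proof -
  have "real (strlen c) / t' \<le> real (strlen c) / t"
    using assms by (intro divide_left_mono) auto
  then show ?thesis by (simp add: weight_def)
qed

lemma weight_le_mult_weight_1: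
  assumes "0 < t" "t \<le> 1" "l \<le> strlen c"
  shows "weight t c \<le> 2 powr (- (real l * (1 / t - 1))) * weight 1 c"
proof -
  have "real l * (1 / t - 1) \<le> real (strlen c) * (1 / t - 1)"
    using assms by (intro mult_right_mono) auto
  then have "2 powr (- (real (strlen c) * (1 / t - 1))) \<le> (2::real) powr (- (real l * (1 / t - 1)))"
    by (intro powr_mono) auto
  then show ?thesis
    using weight_eq_mult[of t c 1] by (simp add: mult.commute)
qed

lemma strlen_mult_weight_le:
  assumes "0 < t" "t \<le> s" "s < 1"
  shows "real (strlen c) * ln 2 * weight t c \<le> weight 1 c / (1 / s - 1)"
proof -
  define \<beta> where "\<beta> = 1 / s - 1"
  define y where "y = real (strlen c) * \<beta> * ln 2"
  have beta_pos: "0 < \<beta>" using assms by (simp add: \<beta>_def)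
  have "y \<le> exp y" using exp_ge_add_one_self[of y] by linarith
  then have y_exp: "y * exp (- y) \<le> 1" by (simp add: exp_minus field_simps)
  have "real (strlen c) * ln 2 * weight t c \<le> real (strlen c) * ln 2 * weight s c"
    using assms by (intro mult_left_mono weight_mono) auto
  also have "weight s c = weight 1 c * exp (- y)"
    using weight_eq_mult[of s c 1] by (simp add: powr_def \<beta>_def y_def)
  also have "real (strlen c) * ln 2 * (weight 1 c * exp (- y)) = weight 1 c / \<beta> * (y * exp (- y))"
    using beta_pos by (simp add: y_def)
  also have "\<dots> \<le> weight 1 c / \<beta>"
    using y_exp beta_pos by (intro mult_right_le_one_le) (auto simp: y_def)
  finally show ?thesis by (simp add: \<beta>_def)
qed

lemma weight_Lipschitz:
  assumes t_bounds: "0 < T" "T \<le> t" "t \<le> s" and s_less: "s < 1"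
  shows "weight t c \<le> weight T c + (t - T) / (T\<^sup>2 * (1 / s - 1)) * weight 1 c"
proof -
  define x where "x = real (strlen c) * (1 / T - 1 / t) * ln 2"
  have "1 / T - 1 / t = (t - T) / (T * t)" using t_bounds by (simp add: field_simps)
  also have "\<dots> \<le> (t - T) / T\<^sup>2"
    using t_bounds by (intro divide_left_mono) (auto simp: power2_eq_square)
  finally have x_le: "x \<le> real (strlen c) * ((t - T) / T\<^sup>2) * ln 2"
    unfolding x_def by (intro mult_right_mono mult_left_mono) auto
  have "weight T c = weight t c * exp (- x)"
    using weight_eq_mult[of T c t] by (simp add: powr_def x_def)
  moreover have "1 - exp (- x) \<le> x" using exp_ge_add_one_self[of "- x"] by linarith
  ultimately have "weight t c - weight T c \<le> weight t c * x"
    using weight_nonneg[of t c] by (metis mult_left_mono mult.right_neutral right_diff_distrib)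
  also have "\<dots> \<le> weight t c * (real (strlen c) * ((t - T) / T\<^sup>2) * ln 2)"
    by (intro mult_left_mono x_le) simp
  also have "\<dots> = (t - T) / T\<^sup>2 * (real (strlen c) * ln 2 * weight t c)"
    by simp
  also have "\<dots> \<le> (t - T) / T\<^sup>2 * (weight 1 c / (1 / s - 1))"
    using t_bounds s_less by (intro mult_left_mono strlen_mult_weight_le) auto
  finally show ?thesis by simp
qed

lemma weight_decrease:
  assumes t_bounds: "0 < t" "t \<le> T" "T \<le> 1" and strlen_c: "1 \<le> strlen c"
  shows "weight t c \<le> weight T c * (1 - (T - t) / 4)"
proof -
  define y where "y = T - t"
  have y_bounds: "0 \<le> y" "y \<le> 1" using t_bounds by (auto simp: y_def)
  define x where "x = real (strlen c) * (1 / t - 1 / T) * ln 2"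
  have "t * T \<le> 1 * 1" using t_bounds by (intro mult_mono) auto
  then have "y / 1 \<le> y / (t * T)" using y_bounds t_bounds by (intro divide_left_mono) auto
  also have "y / (t * T) = 1 / t - 1 / T" using t_bounds by (simp add: y_def field_simps)
  finally have "1 * y \<le> real (strlen c) * (1 / t - 1 / T)"
    using strlen_c y_bounds by (intro mult_mono) auto
  then have "y * (2 / 3) \<le> x"
    unfolding x_def using y_bounds ln2_ge_two_thirds by (intro mult_mono) auto
  then have "exp (- x) \<le> exp (- (2 / 3 * y))" by simp
  also have "\<dots> \<le> 1 / (1 + 2 / 3 * y)"
    using exp_ge_add_one_self[of "2 / 3 * y"] y_bounds
    by (simp add: exp_minus inverse_eq_divide divide_left_mono)
  also have "\<dots> \<le> 1 - y / 4"
  proof -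
    have "y * y \<le> 1 * y" using y_bounds by (intro mult_right_mono) auto
    then show ?thesis using y_bounds by (simp add: field_simps)
  qed
  finally have "weight T c * exp (- x) \<le> weight T c * (1 - y / 4)"
    by (intro mult_left_mono) auto
  moreover have "weight t c = weight T c * exp (- x)"
    using weight_eq_mult[of t c T] by (simp add: powr_def x_def)
  ultimately show ?thesis by (simp add: y_def)
qed

text \<open>For \<open>t = j / 2\<^sup>n\<close>, taking \<open>j\<close>-th powers turns \<open>2\<^sup>P \<cdot> 2\<^bsup>-m/t\<^esup> < y + 1\<close> into a comparison of
  natural numbers.\<close>

definition scaled_weight :: "nat \<Rightarrow> nat \<Rightarrow> nat \<Rightarrow> nat \<Rightarrow> nat" where
  "scaled_weight P m n j =
     bounded_least (\<lambda>y. 2 ^ (P * j) < Suc y ^ j * 2 ^ (m * 2 ^ n)) (Suc (2 ^ P))"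

lemma rec_env_scaled_weight [rec_env_intros]:
  assumes "rec_env F" "rec_env G" "rec_env H" "rec_env I"
  shows "rec_env (\<lambda>e. scaled_weight (F e) (G e) (H e) (I e))"
  unfolding scaled_weight_def
  by (intro rec_env_intros assms assms[THEN rec_env_shift])

lemma power_mult_power_le_iff:
  assumes "0 < j"
  shows "y ^ j * 2 ^ (m * 2 ^ n) \<le> (2 :: nat) ^ (P * j) \<longleftrightarrow>
    real y \<le> 2 ^ P * 2 powr (- real m / (real j / 2 ^ n))"
proof -
  define r :: real where "r = 2 ^ P * 2 powr (- real m / (real j / 2 ^ n))"
  have "r ^ j = 2 ^ (P * j) * (2 powr (- real m / (real j / 2 ^ n))) ^ j"
    by (simp add: r_def power_mult_distrib power_mult)
  also have "(2 powr (- real m / (real j / 2 ^ n))) ^ j = 2 powr (- real (m * 2 ^ n))"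
    using assms by (simp add: powr_realpow[symmetric] powr_powr)
  also have "\<dots> = 1 / 2 ^ (m * 2 ^ n)"
    by (simp add: powr_minus powr_realpow inverse_eq_divide del: of_nat_mult)
  finally have power_r: "r ^ j * 2 ^ (m * 2 ^ n) = 2 ^ (P * j)" by simp
  have "y ^ j * 2 ^ (m * 2 ^ n) \<le> 2 ^ (P * j) \<longleftrightarrow>
      real (y ^ j * 2 ^ (m * 2 ^ n)) \<le> real (2 ^ (P * j))" by (rule of_nat_le_iff[symmetric])
  also have "\<dots> \<longleftrightarrow> real y ^ j * 2 ^ (m * 2 ^ n) \<le> r ^ j * 2 ^ (m * 2 ^ n)"
    by (simp add: power_r)
  also have "\<dots> \<longleftrightarrow> real y \<le> r"
    using assms by (simp add: power_mono_iff r_def)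
  finally show ?thesis by (simp only: r_def)
qed

lemma scaled_weight_eq_floor:
  assumes "0 < j"
  shows "scaled_weight P m n j = nat \<lfloor>2 ^ P * 2 powr (- real m / (real j / 2 ^ n))\<rfloor>"
proof -
  define r :: real where "r = 2 ^ P * 2 powr (- real m / (real j / 2 ^ n))"
  have "2 powr (- real m / (real j / 2 ^ n)) \<le> (2::real) powr 0"
    by (intro powr_mono) auto
  then have r_bounds: "0 \<le> r" "r \<le> 2 ^ P" by (auto simp: r_def)
  have above: "2 ^ (P * j) < Suc y ^ j * 2 ^ (m * 2 ^ n) \<longleftrightarrow> r < real (Suc y)" for y
    using power_mult_power_le_iff[OF assms, of "Suc y" m n P] unfolding r_def by linarith
  show ?thesis
    unfolding scaled_weight_def above r_def[symmetric]
  proof (rule bounded_least_eqI)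
    have "real (nat \<lfloor>r\<rfloor>) \<le> 2 ^ P" using of_nat_floor[OF r_bounds(1)] r_bounds(2) by linarith
    then have "real (nat \<lfloor>r\<rfloor>) \<le> real (2 ^ P)" by (simp only: of_nat_power of_nat_numeral)
    then show "nat \<lfloor>r\<rfloor> < Suc (2 ^ P)" by (simp only: of_nat_le_iff less_Suc_eq_le)
    show "r < real (Suc (nat \<lfloor>r\<rfloor>))" using r_bounds by simp linarith
    show "\<not> r < real (Suc y)" if "y < nat \<lfloor>r\<rfloor>" for y
      using that by linarith
  qed
qed

lemma fraction_diff_less_iff:
  fixes a b q n r s d :: nat
  assumes "0 < q" "0 < n" "0 < d"
  shows "(real a - real b) / real q - real r / real n < real s / real d \<longleftrightarrow>
    a * d * n < s * q * n + b * d * n + r * q * d"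
proof -
  have "a * d * n < s * q * n + b * d * n + r * q * d \<longleftrightarrow>
      0 < real (s * q * n + b * d * n + r * q * d) - real (a * d * n)"
    by (simp only: diff_gt_0_iff_gt of_nat_less_iff)
  also have "real (s * q * n + b * d * n + r * q * d) - real (a * d * n) =
      (real s / d - ((real a - b) / q - real r / n)) * (real d * q * n)"
    using assms by (simp add: field_simps)
  also have "0 < \<dots> \<longleftrightarrow> (real a - b) / q - real r / n < real s / d"
    using assms by (simp add: zero_less_mult_iff mult_less_0_iff)
  finally show ?thesis by simp
qed

lemma computable_real_lower_test:
  assumes "computable_real x"
  obtains P where "decidable3 P"
    and "\<And>n s d. 0 < n \<Longrightarrow> 0 < d \<Longrightarrow> x - 2 / real n \<le> real s / real d \<Longrightarrow> P n s d"
    and "\<And>n s d. 0 < n \<Longrightarrow> 0 < d \<Longrightarrow> P n s d \<Longrightarrow> x - 4 / real n < real s / real d"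
proof -
  obtain a b c where rec: "total_recursive a" "total_recursive b" "total_recursive c"
    and approx: "\<And>n. 1 \<le> n \<Longrightarrow>
      \<bar>x - (real (a n) - real (b n)) / real (c n + 1)\<bar> < 1 / real n"
    using assms unfolding computable_real_def by blast
  define P where "P n s d \<longleftrightarrow>
    a n * d * n < s * (c n + 1) * n + b n * d * n + 3 * (c n + 1) * d" for n s d
  have P_iff: "P n s d \<longleftrightarrow>
      (real (a n) - real (b n)) / real (c n + 1) - 3 / real n < real s / real d"
    if "0 < n" "0 < d" for n s d
    using fraction_diff_less_iff[of "c n + 1" n d "a n" "b n" 3 s] that
    by (simp add: P_def)
  show ?thesis
  proof (rule that[of P])
    show "decidable3 P"
      unfolding decidable3_def P_def
      by (intro rec_env_intros rec[THEN rec_env_total_recursive])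
    fix n s d :: nat assume pos: "0 < n" "0 < d"
    have "1 / real n + 1 / real n = 2 / real n" "1 / real n + 3 / real n = 4 / real n"
      "1 / real n + 2 / real n = 3 / real n"
      by (simp_all flip: add_divide_distrib)
    moreover have "\<bar>x - (real (a n) - real (b n)) / real (c n + 1)\<bar> < 1 / real n"
      using pos by (intro approx) simp
    ultimately show "x - 2 / real n \<le> real s / real d \<Longrightarrow> P n s d"
      and "P n s d \<Longrightarrow> x - 4 / real n < real s / real d"
      unfolding P_iff[OF pos] by linarith+
  qed
qed

locale kraft_enumeration =
  fixes A :: "nat \<Rightarrow> nat set"
  assumes decidable_A: "decidable2 (\<lambda>k c. c \<in> A k)"
    and A_subset: "A k \<subseteq> {..<k}"
    and mono_A: "mono A"
    and kraft: "finite F \<Longrightarrow> F \<subseteq> (\<Union>k. A k) \<Longrightarrow> sum (weight 1) F \<le> 1/2"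
begin

definition Z :: "nat \<Rightarrow> real \<Rightarrow> real" where
  "Z k t = sum (weight t) (A k)"

lemma finite_A: "finite (A k)"
  by (rule finite_subset[OF A_subset]) simp

lemma Z_mono: "0 < t \<Longrightarrow> t \<le> t' \<Longrightarrow> Z k t \<le> Z k t'"
  unfolding Z_def by (intro sum_mono weight_mono)

lemma Z_1_le: "Z k 1 \<le> 1/2"
  unfolding Z_def by (intro kraft finite_A) auto

lemma weight_summable:
  assumes "0 < T" "T \<le> 1"
  shows "weight T summable_on (\<Union>k. A k)"
proof (rule nonneg_bounded_partial_sums_imp_summable_on)
  show "eventually (\<lambda>F. sum (weight T) F \<le> 1/2) (finite_subsets_at_top (\<Union>k. A k))"
  proof (rule eventually_finite_subsets_at_top_weakI)
    fix F assume listed: "finite F" "F \<subseteq> (\<Union>k. A k)"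
    have "sum (weight T) F \<le> sum (weight 1) F" using assms by (intro sum_mono weight_mono) auto
    also have "\<dots> \<le> 1/2" by (rule kraft[OF listed])
    finally show "sum (weight T) F \<le> 1/2" .
  qed
qed simp

lemma Z_Lipschitz:
  assumes t_bounds: "0 < T" "T \<le> t" "t \<le> s" "s < 1"
  shows "Z k t \<le> Z k T + (t - T) / (T\<^sup>2 * (1 / s - 1))"
proof -
  have "Z k t \<le> (\<Sum>c\<in>A k. weight T c + (t - T) / (T\<^sup>2 * (1 / s - 1)) * weight 1 c)"
    unfolding Z_def by (intro sum_mono weight_Lipschitz t_bounds)
  also have "\<dots> = Z k T + (t - T) / (T\<^sup>2 * (1 / s - 1)) * Z k 1"
    by (simp add: Z_def sum.distrib sum_distrib_left)
  also have "\<dots> \<le> Z k T + (t - T) / (T\<^sup>2 * (1 / s - 1)) * 1"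
    using t_bounds Z_1_le[of k] by (intro add_left_mono mult_left_mono) auto
  finally show ?thesis by simp
qed

lemma strlen_pos: "c \<in> (\<Union>k. A k) \<Longrightarrow> 1 \<le> strlen c"
  using kraft[of "{c}"] by (cases "strlen c") (auto simp: weight_1)

lemma Z_decrease:
  assumes listed: "c \<in> A k" and t_bounds: "0 < t" "t \<le> T" "T \<le> 1"
  shows "Z k t \<le> Z k T - weight T c * ((T - t) / 4)"
proof -
  have "weight t c \<le> weight T c * (1 - (T - t) / 4)"
    using listed t_bounds by (intro weight_decrease strlen_pos) auto
  moreover have "sum (weight t) (A k - {c}) \<le> sum (weight T) (A k - {c})"
    using t_bounds by (intro sum_mono weight_mono)
  ultimately show ?thesis
    unfolding Z_def sum.remove[OF finite_A listed] by (simp add: algebra_simps)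
qed

definition scaled_Z :: "nat \<Rightarrow> nat \<Rightarrow> nat \<Rightarrow> nat" where
  "scaled_Z k n j = (\<Sum>c<k. if c \<in> A k then scaled_weight (2 * k) (strlen c) n j else 0)"

lemma rec_env_scaled_Z:
  assumes "rec_env F" "rec_env G" "rec_env H"
  shows "rec_env (\<lambda>e. scaled_Z (F e) (G e) (H e))"
  unfolding scaled_Z_def
  by (intro rec_env_intros assms assms[THEN rec_env_shift] dec_env_decidable2[OF decidable_A])

lemma sum_if_A:
  fixes f :: "nat \<Rightarrow> 'a::comm_monoid_add"
  shows "(\<Sum>c<k. if c \<in> A k then f c else 0) = sum f (A k)"
  using A_subset[of k] by (simp add: sum.If_cases Int_absorb1)

lemma scaled_Z_bounds:
  assumes "0 < j"
  shows "real (scaled_Z k n j) / 4 ^ k \<le> Z k (real j / 2 ^ n)"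
    and "Z k (real j / 2 ^ n) - 1 / 2 ^ k \<le> real (scaled_Z k n j) / 4 ^ k"
proof -
  define t where "t = real j / 2 ^ n"
  define sw where "sw c = real (scaled_weight (2 * k) (strlen c) n j)" for c
  have sw_eq: "sw c = real (nat \<lfloor>4 ^ k * weight t c\<rfloor>)" for c
    using scaled_weight_eq_floor[OF assms, of "2 * k" "strlen c" n]
    by (simp add: sw_def weight_def t_def power_mult)
  have sw_bounds: "sw c \<le> 4 ^ k * weight t c" "4 ^ k * weight t c \<le> sw c + 1" for c
    by (simp_all add: sw_eq)
  have scaled_Z_eq_sum: "real (scaled_Z k n j) = sum sw (A k)"
    by (simp add: scaled_Z_def sum_if_A sw_def)
  have Z_eq_sum: "4 ^ k * Z k t = (\<Sum>c\<in>A k. 4 ^ k * weight t c)"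
    by (simp add: Z_def sum_distrib_left)
  have "real (scaled_Z k n j) \<le> 4 ^ k * Z k t"
    unfolding scaled_Z_eq_sum Z_eq_sum by (intro sum_mono sw_bounds)
  then show "real (scaled_Z k n j) / 4 ^ k \<le> Z k (real j / 2 ^ n)"
    by (simp add: t_def field_simps)
  have "4 ^ k * Z k t \<le> (\<Sum>c\<in>A k. sw c + 1)"
    unfolding Z_eq_sum by (intro sum_mono sw_bounds)
  also have "\<dots> = real (scaled_Z k n j) + real (card (A k))"
    by (simp add: scaled_Z_eq_sum sum.distrib)
  also have "card (A k) \<le> 2 ^ k"
    using card_mono[OF finite_lessThan A_subset[of k]] less_exp[of k] unfolding card_lessThan
    by linarith
  finally have "4 ^ k * Z k t \<le> real (scaled_Z k n j) + 2 ^ k" by simp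
  then have "Z k t \<le> (real (scaled_Z k n j) + 2 ^ k) / 4 ^ k"
    by (simp add: field_simps)
  also have "\<dots> = real (scaled_Z k n j) / 4 ^ k + 1 / 2 ^ k"
    by (simp add: add_divide_distrib power_divide[symmetric] flip: power_one_over)
  finally show "Z k (real j / 2 ^ n) - 1 / 2 ^ k \<le> real (scaled_Z k n j) / 4 ^ k"
    by (simp add: t_def)
qed

lemma eventually_subset_A:
  assumes "finite F" "F \<subseteq> (\<Union>k. A k)"
  shows "eventually (\<lambda>k. F \<subseteq> A k) sequentially"
proof -
  have "eventually (\<lambda>k. \<forall>c\<in>F. c \<in> A k) sequentially"
  proof (rule eventually_ball_finite[OF assms(1)], rule ballI)
    fix c assume "c \<in> F"
    then obtain k where "c \<in> A k" using assms(2) by blast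
    then show "eventually (\<lambda>k. c \<in> A k) sequentially"
      using monoD[OF mono_A] unfolding eventually_sequentially by blast
  qed
  then show ?thesis by eventually_elim auto
qed

definition fresh :: "nat \<Rightarrow> nat \<Rightarrow> nat" where
  "fresh k l = bounded_least (\<lambda>c. strlen c = l \<and> c \<notin> A k) (2 ^ Suc l)"

lemma rec_env_fresh:
  assumes "rec_env F" "rec_env G"
  shows "rec_env (\<lambda>e. fresh (F e) (G e))"
  unfolding fresh_def
  by (intro rec_env_intros assms assms[THEN rec_env_shift] dec_env_decidable2[OF decidable_A])

lemma strlen_fresh: "strlen (fresh k l) = l" and fresh_notin: "fresh k l \<notin> A k"
proof -
  have "\<exists>c. strlen c = l \<and> c \<notin> A k"
  proof (rule ccontr)
    define I where "I = {(2::nat) ^ l - 1..<2 ^ Suc l - 1}"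
    have len: "strlen c = l" if "c \<in> I" for c
      using that unfolding I_def by (intro strlen_eqI) auto
    assume "\<not> ?thesis"
    then have "I \<subseteq> A k" using len by blast
    then have "sum (weight 1) I \<le> 1/2"
      by (intro kraft finite_subset[OF _ finite_A]) auto
    moreover have "sum (weight 1) I = real (card I) * (1/2) ^ l"
      using len by (simp add: weight_1)
    moreover have "card I = 2 ^ l" by (simp add: I_def)
    ultimately show False by (simp add: power_one_over)
  qed
  then obtain c where "strlen c = l \<and> c \<notin> A k" by blast
  then have "strlen (fresh k l) = l \<and> fresh k l \<notin> A k"
    unfolding fresh_def using strlen_bounds(2)[of c]
    by (intro bounded_leastI[of "\<lambda>c. strlen c = l \<and> c \<notin> A k" c]) auto
  then show "strlen (fresh k l) = l" "fresh k l \<notin> A k" by auto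
qed

end

locale computable_partition_function = kraft_enumeration +
  fixes T \<theta> :: real and lower_test :: "nat \<Rightarrow> nat \<Rightarrow> nat \<Rightarrow> bool"
  assumes nonempty: "(\<Union>k. A k) \<noteq> {}"
    and T_pos: "0 < T" and T_less: "T < 1"
    and theta: "(weight T has_sum \<theta>) (\<Union>k. A k)"
    and decidable_lower_test: "decidable3 lower_test"
    and lower_testI: "0 < n \<Longrightarrow> 0 < d \<Longrightarrow> \<theta> - 2 / real n \<le> real s / real d \<Longrightarrow> lower_test n s d"
    and lower_testD: "0 < n \<Longrightarrow> 0 < d \<Longrightarrow> lower_test n s d \<Longrightarrow> \<theta> - 4 / real n < real s / real d"
begin

lemma Z_le: "Z k T \<le> \<theta>"
  unfolding Z_def by (intro finite_sum_le_has_sum[OF theta] finite_A) auto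

lemma weight_le_gap:
  assumes "c \<in> (\<Union>k. A k)" "c \<notin> A k"
  shows "weight T c \<le> \<theta> - Z k T"
proof -
  have "sum (weight T) (insert c (A k)) \<le> \<theta>"
    using assms finite_A by (intro finite_sum_le_has_sum[OF theta]) auto
  then show ?thesis using assms(2) finite_A by (simp add: Z_def)
qed

lemma eventually_Z_ge:
  assumes "0 < \<epsilon>"
  shows "eventually (\<lambda>k. \<theta> - \<epsilon> \<le> Z k T) sequentially"
proof -
  have "eventually (\<lambda>F. \<theta> - \<epsilon> < sum (weight T) F) (finite_subsets_at_top (\<Union>k. A k))"
    using theta assms unfolding has_sum_def by (intro order_tendstoD) auto
  then obtain F where large_F: "finite F" "F \<subseteq> (\<Union>k. A k)" "\<theta> - \<epsilon> < sum (weight T) F"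
    unfolding eventually_finite_subsets_at_top by blast
  from eventually_subset_A[OF large_F(1,2)] show ?thesis
  proof eventually_elim
    case (elim k)
    then have "sum (weight T) F \<le> Z k T"
      unfolding Z_def by (intro sum_mono2 finite_A) auto
    with large_F(3) show ?case by simp
  qed
qed

definition Z_test :: "nat \<Rightarrow> nat \<Rightarrow> nat \<Rightarrow> bool" where
  "Z_test n j k \<longleftrightarrow> n \<le> k \<and> lower_test (2 ^ n) (scaled_Z k n j) (4 ^ k)"

lemma dec_env_Z_test:
  assumes "rec_env F" "rec_env G" "rec_env H"
  shows "dec_env (\<lambda>e. Z_test (F e) (G e) (H e))"
  unfolding Z_test_def
  by (intro rec_env_intros dec_env_decidable3[OF decidable_lower_test] rec_env_scaled_Z assms)

lemma Z_testD:
  assumes "Z_test n j k" "0 < j"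
  shows "\<theta> - 4 / 2 ^ n < Z k (real j / 2 ^ n)"
proof -
  have "\<theta> - 4 / real (2 ^ n) < real (scaled_Z k n j) / real (4 ^ k)"
    using assms(1) by (intro lower_testD) (auto simp: Z_test_def)
  then show ?thesis
    using scaled_Z_bounds(1)[OF assms(2), of k n] by simp
qed

lemma Z_testI:
  assumes T_le: "T \<le> real j / 2 ^ n" and Z_ge: "\<theta> - 1 / 2 ^ n \<le> Z k T" and "n \<le> k"
  shows "Z_test n j k"
proof -
  have "0 < real j / 2 ^ n" using T_le T_pos by linarith
  then have j_pos: "0 < j" by (simp add: zero_less_divide_iff)
  have "(2::real) / 2 ^ n = 1 / 2 ^ n + 1 / 2 ^ n"
    by (simp flip: add_divide_distrib)
  moreover have "1 / 2 ^ k \<le> (1::real) / 2 ^ n" using \<open>n \<le> k\<close>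
    by (intro divide_left_mono) (auto intro: power_increasing)
  moreover have "Z k T \<le> Z k (real j / 2 ^ n)" using T_le T_pos by (intro Z_mono)
  ultimately have "\<theta> - 2 / 2 ^ n \<le> real (scaled_Z k n j) / 4 ^ k"
    using Z_ge scaled_Z_bounds(2)[OF j_pos, of k n] by linarith
  then show ?thesis
    using \<open>n \<le> k\<close> by (auto simp: Z_test_def intro!: lower_testI)
qed

lemma eventually_Z_test:
  assumes "T \<le> real j / 2 ^ n"
  shows "eventually (Z_test n j) sequentially"
  using eventually_Z_ge[of "1 / 2 ^ n", simplified] eventually_ge_at_top[of n]
  by eventually_elim (rule Z_testI[OF assms])

definition truncation :: "nat \<Rightarrow> nat" where
  "truncation n = nat \<lfloor>2 ^ n * T\<rfloor>"

lemma truncation_bounds: "real (truncation n) \<le> 2 ^ n * T" "2 ^ n * T < real (truncation n) + 1"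
  using T_pos by (simp_all add: truncation_def)

lemma truncation_less: "truncation n < 2 ^ n"
proof -
  have "2 ^ n * T < real (2 ^ n)" using T_less by simp
  with truncation_bounds(1)[of n] have "real (truncation n) < real (2 ^ n)" by linarith
  then show ?thesis by (simp only: of_nat_less_iff)
qed

lemma le_Suc_truncation: "T \<le> real (Suc (truncation n)) / 2 ^ n"
  using truncation_bounds(2)[of n] by (simp add: field_simps)

lemma truncation_diff:
  assumes "r \<le> n"
  shows "truncation (n - r) = truncation n div 2 ^ r"
proof -
  have "\<lfloor>2 ^ (n - r) * T\<rfloor> = \<lfloor>2 ^ n * T / real_of_int (2 ^ r)\<rfloor>"
    using assms by (simp add: power_diff)
  also have "\<dots> = \<lfloor>2 ^ n * T\<rfloor> div 2 ^ r" by (rule floor_divide_real_eq_div) simp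
  finally show ?thesis
    using T_pos by (simp add: truncation_def nat_div_distrib nat_power_eq)
qed

lemma Suc_str_code_prefix_bits_T: "Suc (str_code (prefix_bits T n)) = 2 ^ n + truncation n"
proof -
  have "frac T = T" using T_pos T_less by (simp add: frac_eq)
  then show ?thesis using Suc_str_code_prefix_bits[of T n] by (simp add: truncation_def)
qed

end

section \<open>Randomness\<close>

context computable_partition_function
begin

lemma ex_strlen_unlisted_gt:
  "\<exists>b::nat. \<forall>n k c. Z_test n (Suc (truncation n)) k \<longrightarrow> c \<in> (\<Union>k. A k) \<longrightarrow> c \<notin> A k \<longrightarrow>
     T * real n - real b < real (strlen c)"
proof -
  define s where "s = (1 + T) / 2"
  define L where "L = 1 / (T\<^sup>2 * (1 / s - 1))"
  have L_nonneg: "0 \<le> L" using T_pos T_less by (simp add: L_def s_def)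
  obtain n0 :: nat where n0_less: "(1/2) ^ n0 < (1 - T) / 2"
    using real_arch_pow_inv[of "(1 - T) / 2" "1/2"] T_less by auto
  obtain b0 :: nat where b0_ge: "T * log 2 (4 + L) \<le> real b0" using real_arch_simple by blast
  have "T * real n - real (b0 + n0) < real (strlen c)"
    if test: "Z_test n (Suc (truncation n)) k" and unlisted: "c \<in> (\<Union>k. A k)" "c \<notin> A k" for n k c
  proof (cases "n0 \<le> n")
    case True
    define t where "t = real (Suc (truncation n)) / 2 ^ n"
    have t_bounds: "T \<le> t" "t - T \<le> 1 / 2 ^ n"
      using le_Suc_truncation truncation_bounds(1)[of n] by (simp_all add: t_def field_simps)
    have "(1/2 :: real) ^ n \<le> (1/2) ^ n0" using True by (intro power_decreasing) auto
    then have "t - T \<le> (1 - T) / 2" using n0_less t_bounds(2) unfolding power_one_over by linarith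
    then have "t \<le> s" by (simp add: s_def field_simps)
    then have "Z k t \<le> Z k T + L * (t - T)"
      using Z_Lipschitz[of T t s k] T_pos T_less t_bounds(1) by (simp add: L_def s_def)
    also have "\<dots> \<le> Z k T + L * (1 / 2 ^ n)"
      using t_bounds(2) L_nonneg by (intro add_left_mono mult_left_mono)
    finally have "Z k t \<le> Z k T + L * (1 / 2 ^ n)" .
    moreover have "\<theta> - 4 / 2 ^ n < Z k t" unfolding t_def by (rule Z_testD[OF test]) simp
    ultimately have "weight T c < 4 / 2 ^ n + L * (1 / 2 ^ n)"
      using weight_le_gap[OF unlisted] by linarith
    also have "\<dots> = 2 powr (log 2 (4 + L) - real n)"
      using L_nonneg by (simp add: powr_diff powr_realpow add_divide_distrib)
    finally have "T * real n - T * log 2 (4 + L) < real (strlen c)"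
      using T_pos by (simp add: weight_def field_simps)
    with b0_ge show ?thesis by simp
  next
    case False
    then have "T * real n \<le> 1 * real n0" using T_pos T_less by (intro mult_mono) auto
    moreover have "0 < real (strlen c)" using strlen_pos[OF unlisted(1)] by linarith
    ultimately show ?thesis unfolding of_nat_add by linarith
  qed
  then show ?thesis by blast
qed

text \<open>Unlike \<open>T n - b\<close> itself, this is computable from the first \<open>n\<close> bits of \<open>T\<close>.\<close>

definition cutoff :: "nat \<Rightarrow> nat \<Rightarrow> nat \<Rightarrow> nat" where
  "cutoff b n J = n * J div 2 ^ n - b"

lemma cutoff_le:
  assumes "cutoff b n (truncation n) \<noteq> 0"
  shows "real (cutoff b n (truncation n)) \<le> T * real n - real b"
proof -
  have "real (n * truncation n div 2 ^ n) \<le> real (n * truncation n) / 2 ^ n"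
    using of_nat_div_le_of_nat[of "n * truncation n" "2 ^ n", where ?'a = real] by simp
  also have "\<dots> \<le> real n * (2 ^ n * T) / 2 ^ n"
    using truncation_bounds(1) by (intro divide_right_mono) (auto intro: mult_left_mono)
  finally show ?thesis using assms by (simp add: cutoff_def mult.commute)
qed

lemma cutoff_ge: "T * real n - real b - 2 \<le> real (cutoff b n (truncation n))"
proof -
  have "real n \<le> 2 ^ n" by (metis less_exp less_imp_le of_nat_le_iff of_nat_numeral of_nat_power)
  then have "real n * (2 ^ n * T - real (truncation n)) \<le> 2 ^ n * 1"
    using truncation_bounds[of n] by (intro mult_mono) auto
  then have "real n * T - real (n * truncation n) / 2 ^ n \<le> 1" by (simp add: field_simps)
  moreover have "real (n * truncation n) / 2 ^ n - 1 \<le> real (n * truncation n div 2 ^ n)"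
    using floor_divide_of_nat_eq[of "n * truncation n" "2 ^ n", where ?'a = real]
      real_of_int_floor_ge_diff_one[of "real (n * truncation n) / 2 ^ n"] by simp
  ultimately show ?thesis by (simp add: cutoff_def mult.commute)
qed

lemma ex_fresh_cutoff_unlisted:
  "\<exists>b. \<forall>n k. Z_test n (Suc (truncation n)) k \<longrightarrow>
     fresh k (cutoff b n (truncation n)) \<notin> (\<Union>k. A k)"
proof -
  obtain b :: nat where strlen_gt: "\<And>n k c. Z_test n (Suc (truncation n)) k \<Longrightarrow> c \<in> (\<Union>k. A k) \<Longrightarrow>
      c \<notin> A k \<Longrightarrow> T * real n - real b < real (strlen c)"
    using ex_strlen_unlisted_gt by blast
  have "fresh k (cutoff b n (truncation n)) \<notin> (\<Union>k. A k)"
    if test: "Z_test n (Suc (truncation n)) k" for n k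
  proof
    assume listed: "fresh k (cutoff b n (truncation n)) \<in> (\<Union>k. A k)"
    from strlen_gt[OF test this fresh_notin]
    have "T * real n - real b < real (cutoff b n (truncation n))"
      by (simp add: strlen_fresh)
    with cutoff_le have "cutoff b n (truncation n) = 0" by fastforce
    with strlen_pos[OF listed] show False by (simp add: strlen_fresh)
  qed
  then show ?thesis by blast
qed

lemma ex_cutoff_le_Hc:
  assumes optimal_U: "optimal_machine U" and optimal_V: "optimal_machine V"
    and listed_eq: "(\<Union>k. A k) = str_code ` compressible_strings V"
  shows "\<exists>b d. \<forall>n. enat (cutoff b n (truncation n)) \<le> Hc U (prefix_bits T n) + enat d"
proof -
  obtain b where fresh_unlisted: "\<And>n k. Z_test n (Suc (truncation n)) k \<Longrightarrow>
      fresh k (cutoff b n (truncation n)) \<notin> (\<Union>k. A k)"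
    using ex_fresh_cutoff_unlisted by blast
  define R where "R w = Z_test (strlen w) (Suc (Suc w - 2 ^ strlen w))" for w
  define h where "h w k = fresh k (cutoff b (strlen w) (Suc w - 2 ^ strlen w))" for w k
  have "decidable2 R"
    unfolding decidable2_def R_def by (intro dec_env_Z_test rec_env_intros)
  moreover have "recursive2 h"
    unfolding recursive2_def h_def cutoff_def by (intro rec_env_fresh rec_env_intros)
  moreover have "prefix_free_machine U" using optimal_U by (simp add: optimal_machine_def)
  ultimately obtain d where Hc_le: "\<And>w. eventually (R (str_code w)) sequentially \<Longrightarrow>
      \<exists>k. R (str_code w) k \<and> Hc V (str_decode (h (str_code w) k)) \<le> Hc U w + enat d"
    using optimal_machine_image[OF optimal_V, of U R h] by blast
  have "enat (cutoff b n (truncation n)) \<le> Hc U (prefix_bits T n) + enat d" for n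
  proof -
    define w where "w = str_code (prefix_bits T n)"
    have w_eq: "strlen w = n" "Suc w - 2 ^ n = truncation n"
      using Suc_str_code_prefix_bits_T[of n] by (simp_all add: w_def)
    have "eventually (R w) sequentially"
      unfolding R_def w_eq by (intro eventually_Z_test le_Suc_truncation)
    then obtain k where stage_k: "R w k"
      "Hc V (str_decode (h w k)) \<le> Hc U (prefix_bits T n) + enat d"
      using Hc_le unfolding w_def by blast
    have "h w k \<notin> str_code ` compressible_strings V"
      using fresh_unlisted stage_k(1) unfolding R_def h_def w_eq listed_eq[symmetric] by blast
    then have "str_decode (h w k) \<notin> compressible_strings V" by (metis imageI str_code_decode)
    then have "enat (strlen (h w k)) \<le> Hc V (str_decode (h w k))"
      by (simp add: compressible_strings_def not_less)
    with stage_k(2) show ?thesis by (simp add: h_def w_eq strlen_fresh)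
  qed
  then show ?thesis by blast
qed

lemma weakly_Chaitin_random_T:
  assumes "optimal_machine U" "optimal_machine V"
    and "(\<Union>k. A k) = str_code ` compressible_strings V"
  shows "weakly_Chaitin_random U T T"
proof -
  obtain b d where cutoff_le_Hc:
    "\<And>n. enat (cutoff b n (truncation n)) \<le> Hc U (prefix_bits T n) + enat d"
    using ex_cutoff_le_Hc[OF assms] by blast
  show ?thesis
    unfolding weakly_Chaitin_random_def
  proof (intro exI[of _ "b + d + 2"] allI impI)
    fix n :: nat
    show "ereal (T * real n - real (b + d + 2)) \<le> ereal_of_enat (Hc U (prefix_bits T n))"
      using cutoff_le_Hc[of n] cutoff_ge[of n b] by (cases "Hc U (prefix_bits T n)") auto
  qed
qed

end

section \<open>Compressibility\<close>

context kraft_enumeration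
begin

definition settled :: "nat \<Rightarrow> nat \<Rightarrow> bool" where
  "settled l k \<longleftrightarrow> (\<forall>k'. Z k' 1 < Z k 1 + 1 / 2 ^ l)"

lemma sum_unlisted_less:
  assumes settled: "settled l k" and unlisted: "finite F" "F \<subseteq> (\<Union>k. A k)" "F \<inter> A k = {}"
  shows "sum (weight 1) F < 1 / 2 ^ l"
proof -
  have "eventually (\<lambda>k'. F \<union> A k \<subseteq> A k') sequentially"
    using unlisted finite_A by (intro eventually_subset_A) auto
  then obtain k' where listed_by_k': "F \<union> A k \<subseteq> A k'"
    by (auto simp: eventually_sequentially)
  have "sum (weight 1) F + Z k 1 = sum (weight 1) (F \<union> A k)"
    unfolding Z_def using unlisted finite_A by (simp add: sum.union_disjoint)
  also have "\<dots> \<le> Z k' 1"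
    unfolding Z_def using listed_by_k' finite_A by (intro sum_mono2) auto
  finally show ?thesis using settled[unfolded settled_def, rule_format, of k'] by linarith
qed

lemma settled_imp_long:
  assumes "settled l k" "c \<in> (\<Union>k. A k)" "c \<notin> A k"
  shows "l < strlen c"
proof -
  have "(1/2 :: real) ^ strlen c < (1/2) ^ l"
    using sum_unlisted_less[OF assms(1), of "{c}"] assms(2,3)
    by (simp add: weight_1 power_one_over)
  then show ?thesis by (simp add: power_strict_decreasing_iff)
qed

text \<open>\<open>N\<close> is a guess for the first \<open>l\<close> bits of the Kraft sum.\<close>

definition reached :: "nat \<Rightarrow> nat \<Rightarrow> nat \<Rightarrow> bool" where
  "reached l N k \<longleftrightarrow> real N < 2 ^ l * Z k 1"

lemma reached_iff:
  "reached l N k \<longleftrightarrow> N * 2 ^ k < (\<Sum>c<k. if c \<in> A k then 2 ^ (l + k - strlen c) else 0)"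
proof -
  have "(2::real) ^ (l + k - strlen c) = 2 ^ l * weight 1 c * 2 ^ k" if "c \<in> A k" for c
  proof -
    have "strlen c \<le> l + k" using strlen_le[of c] A_subset that by fastforce
    then show ?thesis by (simp add: weight_1 power_diff power_add power_one_over)
  qed
  then have "real (\<Sum>c<k. if c \<in> A k then 2 ^ (l + k - strlen c) else 0) = 2 ^ l * Z k 1 * 2 ^ k"
    by (simp add: sum_if_A Z_def sum_distrib_left sum_distrib_right)
  moreover have "N * 2 ^ k < M \<longleftrightarrow> real N * 2 ^ k < real M" for M
    by (metis of_nat_less_iff of_nat_mult of_nat_numeral of_nat_power)
  ultimately show ?thesis by (simp add: reached_def)
qed

lemma dec_env_reached:
  assumes "rec_env F" "rec_env G" "rec_env H"
  shows "dec_env (\<lambda>e. reached (F e) (G e) (H e))"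
  unfolding reached_iff
  by (intro rec_env_intros assms assms[THEN rec_env_shift] dec_env_decidable2[OF decidable_A])

lemma reached_mono:
  assumes "reached l N k" "k \<le> k'"
  shows "reached l N k'"
proof -
  have "Z k 1 \<le> Z k' 1"
    unfolding Z_def using monoD[OF mono_A assms(2)] by (intro sum_mono2 finite_A) auto
  then have "2 ^ l * Z k 1 \<le> 2 ^ l * Z k' 1" by simp
  with assms(1) show ?thesis unfolding reached_def by linarith
qed

lemma ex_reached_imp_settled:
  assumes "(\<Union>k. A k) \<noteq> {}"
  obtains N where "N < 2 ^ l" "\<exists>k. reached l N k" "\<And>k. reached l N k \<Longrightarrow> settled l k"
proof -
  define P where "P N \<longleftrightarrow> (\<exists>k. reached l N k)" for N
  define N where "N = Greatest P"
  have P_less: "M < 2 ^ l" if "P M" for M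
  proof -
    from that obtain k where "real M < 2 ^ l * Z k 1" by (auto simp: P_def reached_def)
    also have "\<dots> \<le> 2 ^ l * 1" using Z_1_le[of k] by (intro mult_left_mono) auto
    finally have "real M < real (2 ^ l)" by simp
    then show ?thesis by (simp only: of_nat_less_iff)
  qed
  then have P_le: "M \<le> 2 ^ l" if "P M" for M using that less_imp_le by blast
  obtain k c where "c \<in> A k" using assms by blast
  then have "0 < Z k 1" unfolding Z_def by (intro sum_pos finite_A) auto
  then have "P 0" by (auto simp: P_def reached_def intro!: exI[of _ k])
  then have P_N: "P N" unfolding N_def using P_le by (rule GreatestI_nat)
  have "settled l k" if reached_k: "reached l N k" for k
  proof -
    have "2 ^ l * Z k' 1 < 2 ^ l * Z k 1 + 1" for k'
    proof -
      have "\<not> P (Suc N)" using Greatest_le_nat[of P "Suc N" "2 ^ l"] P_le by (auto simp: N_def)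
      then have "2 ^ l * Z k' 1 \<le> real N + 1" by (auto simp: P_def reached_def not_less add.commute)
      then show ?thesis using reached_k by (simp add: reached_def)
    qed
    then show ?thesis by (simp add: settled_def field_simps)
  qed
  then show ?thesis using that[of N] P_N P_less[OF P_N] by (auto simp: P_def)
qed

end

context computable_partition_function
begin

lemma settled_imp_Z_ge:
  assumes settled: "settled l k"
  shows "\<theta> - 2 powr (- real l / T) \<le> Z k T"
proof -
  define \<gamma> :: real where "\<gamma> = 2 powr (- (real l * (1 / T - 1)))"
  have "sum (weight T) F \<le> Z k T + 2 powr (- real l / T)"
    if listed: "finite F" "F \<subseteq> (\<Union>k. A k)" for F
  proof -
    have "sum (weight T) F = sum (weight T) (F \<inter> A k) + sum (weight T) (F - A k)"
      using listed(1) by (rule sum.Int_Diff)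
    also have "sum (weight T) (F \<inter> A k) \<le> Z k T"
      unfolding Z_def by (intro sum_mono2 finite_A) auto
    also have "sum (weight T) (F - A k) \<le> (\<Sum>c\<in>F - A k. \<gamma> * weight 1 c)"
      unfolding \<gamma>_def using listed(2) settled_imp_long[OF settled] T_pos T_less
      by (intro sum_mono weight_le_mult_weight_1) (auto intro: less_imp_le)
    also have "\<dots> = \<gamma> * sum (weight 1) (F - A k)" by (simp add: sum_distrib_left)
    also have "\<dots> \<le> \<gamma> * (1 / 2 ^ l)"
    proof (rule mult_left_mono)
      have "sum (weight 1) (F - A k) < 1 / 2 ^ l"
        using listed by (intro sum_unlisted_less[OF settled]) auto
      then show "sum (weight 1) (F - A k) \<le> 1 / 2 ^ l" by simp
    qed (simp add: \<gamma>_def)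
    also have "\<dots> = 2 powr (- real l / T)"
      by (simp add: \<gamma>_def powr_realpow[symmetric] algebra_simps flip: powr_diff)
    finally show ?thesis by simp
  qed
  then have "\<theta> \<le> Z k T + 2 powr (- real l / T)" by (rule has_sum_le_finite_sums[OF theta])
  then show ?thesis by simp
qed

definition estimate :: "nat \<Rightarrow> nat \<Rightarrow> nat" where
  "estimate n k = bounded_least (\<lambda>j. 0 < j \<and> Z_test n j k) (Suc (2 ^ n))"

lemma rec_env_estimate:
  assumes "rec_env F" "rec_env G"
  shows "rec_env (\<lambda>e. estimate (F e) (G e))"
  unfolding estimate_def
  by (intro rec_env_intros dec_env_Z_test assms assms[THEN rec_env_shift])

lemma Z_test_imp_truncation_le:
  assumes listed: "c \<in> A k" and test: "Z_test n j k" "0 < j"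
  shows "real (truncation n) \<le> real j + 16 / weight T c"
proof (cases "real j / 2 ^ n \<le> T")
  case True
  have "\<theta> - 4 / 2 ^ n < Z k (real j / 2 ^ n)" by (rule Z_testD[OF test])
  also have "\<dots> \<le> Z k T - weight T c * ((T - real j / 2 ^ n) / 4)"
    using test(2) True T_less by (intro Z_decrease listed) auto
  also have "Z k T \<le> \<theta>" by (rule Z_le)
  finally have "weight T c * (T - real j / 2 ^ n) < 16 / 2 ^ n" by simp
  then have "T - real j / 2 ^ n < (16 / weight T c) / 2 ^ n"
    using weight_pos[of T c] by (simp add: field_simps)
  then have "2 ^ n * (T - real j / 2 ^ n) < 16 / weight T c"
    by (subst (asm) pos_less_divide_eq) (simp_all add: mult.commute)
  then have "2 ^ n * T < real j + 16 / weight T c" by (simp add: right_diff_distrib)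
  with truncation_bounds(1)[of n] show ?thesis by linarith
next
  case False
  then have "2 ^ n * T < real j" by (simp add: field_simps)
  moreover have "0 \<le> 16 / weight T c" by simp
  ultimately show ?thesis using truncation_bounds(1)[of n] by linarith
qed

lemma ex_estimate_bounds:
  "\<exists>\<Delta> k0. \<forall>n k. \<theta> - 1 / 2 ^ n \<le> Z k T \<longrightarrow> n \<le> k \<longrightarrow> k0 \<le> k \<longrightarrow>
     estimate n k \<le> Suc (truncation n) \<and> truncation n \<le> estimate n k + \<Delta>"
proof -
  obtain c k0 where listed: "c \<in> A k0" using nonempty by blast
  obtain \<Delta> :: nat where Delta_ge: "16 / weight T c \<le> real \<Delta>" using real_arch_simple by blast
  have "estimate n k \<le> Suc (truncation n) \<and> truncation n \<le> estimate n k + \<Delta>"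
    if Z_ge: "\<theta> - 1 / 2 ^ n \<le> Z k T" and k_ge: "n \<le> k" "k0 \<le> k" for n k
  proof -
    have test: "0 < Suc (truncation n) \<and> Z_test n (Suc (truncation n)) k"
      using Z_testI[OF le_Suc_truncation Z_ge k_ge(1)] by simp
    then have "0 < estimate n k \<and> Z_test n (estimate n k) k"
      unfolding estimate_def using truncation_less[of n]
      by (intro bounded_leastI[of "\<lambda>j. 0 < j \<and> Z_test n j k"]) auto
    moreover have "c \<in> A k" using listed monoD[OF mono_A k_ge(2)] by blast
    ultimately have "real (truncation n) \<le> real (estimate n k) + 16 / weight T c"
      using Z_test_imp_truncation_le by blast
    with Delta_ge have "truncation n \<le> estimate n k + \<Delta>" by linarith
    moreover have "estimate n k \<le> Suc (truncation n)"
      unfolding estimate_def using test by (rule bounded_least_le)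
    ultimately show ?thesis by blast
  qed
  then show ?thesis by blast
qed

lemma ex_settled_stage:
  assumes M_ge: "real K * T \<le> real M"
  shows "\<exists>N<2 ^ (M * a). (\<exists>k\<ge>k1. reached (M * a) N k) \<and>
    (\<forall>k. reached (M * a) N k \<longrightarrow> \<theta> - 1 / 2 ^ (K * a) \<le> Z k T)"
proof -
  obtain N where stages_N: "N < 2 ^ (M * a)" "\<exists>k. reached (M * a) N k"
    "\<And>k. reached (M * a) N k \<Longrightarrow> settled (M * a) k"
    using ex_reached_imp_settled[OF nonempty] by blast
  have "\<exists>k\<ge>k1. reached (M * a) N k"
    using stages_N(2) reached_mono[of "M * a" N _ "max _ k1"]
    by (meson max.cobounded1 max.cobounded2)
  moreover have "\<theta> - 1 / 2 ^ (K * a) \<le> Z k T" if "reached (M * a) N k" for k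
  proof -
    have "real (K * a) * T \<le> real (M * a)"
      using mult_right_mono[OF M_ge, of "real a"] by (simp add: algebra_simps)
    then have "- real (M * a) / T \<le> - real (K * a)"
      using T_pos by (simp add: field_simps)
    then have "2 powr (- real (M * a) / T) \<le> (2::real) powr (- real (K * a))"
      by (intro powr_mono) auto
    also have "\<dots> = 1 / 2 ^ (K * a)"
      by (simp add: powr_minus powr_realpow inverse_eq_divide del: of_nat_mult)
    finally show ?thesis using settled_imp_Z_ge[OF stages_N(3)[OF that]] by linarith
  qed
  ultimately show ?thesis using stages_N(1) by blast
qed

lemma ex_Hc_prefix_bits_le:
  assumes optimal_U: "optimal_machine U" and M_ge: "real K * T \<le> real M"
  shows "\<exists>D. \<forall>a r. r < K \<longrightarrow> r \<le> K * a \<longrightarrow>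
    Hc U (prefix_bits T (K * a - r)) \<le> enat (a + M * a + D)"
proof -
  obtain \<Delta> k0 where est: "\<And>n k. \<theta> - 1 / 2 ^ n \<le> Z k T \<Longrightarrow> n \<le> k \<Longrightarrow> k0 \<le> k \<Longrightarrow>
     estimate n k \<le> Suc (truncation n) \<and> truncation n \<le> estimate n k + \<Delta>"
    using ex_estimate_bounds by blast
  define R where "R a N k \<longleftrightarrow> reached (M * a) N k \<and> K * a + k0 \<le> k" for a N k
  define h where "h = (\<lambda>(r, \<delta>) a (N::nat) k.
    2 ^ (K * a - r) + (estimate (K * a) k + \<delta> - 1) div 2 ^ r - 1)"
  have "decidable3 R"
    unfolding decidable3_def R_def by (intro rec_env_intros dec_env_reached)
  moreover have "recursive3 (h i)" for i
    unfolding recursive3_def h_def case_prod_unfold by (intro rec_env_intros rec_env_estimate)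
  ultimately obtain D where Hc_le: "\<And>r \<delta> a N. r < K \<Longrightarrow> \<delta> < \<Delta> + 2 \<Longrightarrow> N < 2 ^ (M * a) \<Longrightarrow>
      \<exists>k. R a N k \<Longrightarrow> Hc U (str_decode (h (r, \<delta>) a N (LEAST k. R a N k))) \<le> enat (a + M * a + D)"
    using optimal_machine_delimited_finite[OF optimal_U, of R "{..<K} \<times> {..<\<Delta> + 2}" h M] by blast
  have "Hc U (prefix_bits T (K * a - r)) \<le> enat (a + M * a + D)"
    if r_bounds: "r < K" "r \<le> K * a" for a r
  proof -
    obtain N where stages_N: "N < 2 ^ (M * a)" "\<exists>k. R a N k"
      and Z_ge: "\<And>k. reached (M * a) N k \<Longrightarrow> \<theta> - 1 / 2 ^ (K * a) \<le> Z k T"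
      using ex_settled_stage[OF M_ge, of a "K * a + k0"] unfolding R_def by blast
    define k where "k = (LEAST k. R a N k)"
    have "R a N k" unfolding k_def using stages_N(2) by (rule LeastI_ex)
    then have bounds: "estimate (K * a) k \<le> Suc (truncation (K * a))"
      "truncation (K * a) \<le> estimate (K * a) k + \<Delta>"
      using est[OF Z_ge] by (simp_all add: R_def)
    define \<delta> where "\<delta> = Suc (truncation (K * a)) - estimate (K * a) k"
    have delta: "\<delta> < \<Delta> + 2" "estimate (K * a) k + \<delta> - 1 = truncation (K * a)"
      using bounds by (simp_all add: \<delta>_def)
    have "h (r, \<delta>) a N k = str_code (prefix_bits T (K * a - r))"
      using Suc_str_code_prefix_bits_T[of "K * a - r"]
      unfolding h_def prod.case delta(2) truncation_diff[OF r_bounds(2)] by linarith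
    then show ?thesis using Hc_le[OF r_bounds(1) delta(1) stages_N] by (simp flip: k_def)
  qed
  then show ?thesis by blast
qed

lemma ex_Hc_prefix_bits_le_linear:
  assumes optimal_U: "optimal_machine U" and "0 < K" "real K * T \<le> real M"
  shows "\<exists>D. \<forall>n. ereal_of_enat (Hc U (prefix_bits T n)) \<le>
    ereal ((real M + 1) / real K * real n + D)"
proof -
  obtain D where Hc_le: "\<And>a r. r < K \<Longrightarrow> r \<le> K * a \<Longrightarrow>
      Hc U (prefix_bits T (K * a - r)) \<le> enat (a + M * a + D)"
    using ex_Hc_prefix_bits_le[OF optimal_U assms(3)] by blast
  have "ereal_of_enat (Hc U (prefix_bits T n)) \<le>
      ereal ((real M + 1) / real K * real n + (real M + 1 + real D))" for n
  proof -
    define a where "a = (n + (K - 1)) div K"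
    have "K * a + (n + (K - 1)) mod K = n + (K - 1)" by (simp add: a_def)
    moreover have "(n + (K - 1)) mod K < K" using \<open>0 < K\<close> by simp
    ultimately have a_bounds: "n \<le> K * a" "K * a < n + K" by linarith+
    then have "Hc U (prefix_bits T n) \<le> enat (a + M * a + D)"
      using Hc_le[of "K * a - n" a] by simp
    then have "ereal_of_enat (Hc U (prefix_bits T n)) \<le> ereal (real (a + M * a + D))"
      by (metis ereal_of_enat_le_iff ereal_of_enat_simps(1))
    moreover have "real (a + M * a + D) \<le> (real M + 1) / real K * real n + (real M + 1 + real D)"
    proof -
      have "real K * real a \<le> real n + real K"
        using a_bounds(2) by (metis less_imp_le of_nat_add of_nat_le_iff of_nat_mult)
      then have "real a \<le> real n / real K + 1" using \<open>0 < K\<close> by (simp add: field_simps)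
      then have "(real M + 1) * real a \<le> (real M + 1) * (real n / real K + 1)"
        by (intro mult_left_mono) auto
      then show ?thesis by (simp add: algebra_simps)
    qed
    ultimately show ?thesis by (meson ereal_less_eq(3) order_trans)
  qed
  then show ?thesis by blast
qed

end

lemma compressibleI:
  assumes "\<And>y. T < y \<Longrightarrow>
    \<exists>D. \<forall>n. ereal_of_enat (Hc U (prefix_bits \<alpha> n)) \<le> ereal (y * real n + D)"
  shows "compressible U T \<alpha>"
  unfolding compressible_def
proof (rule ereal_le_epsilon2)
  fix \<epsilon> :: real assume eps_pos: "0 < \<epsilon>"
  then obtain D where Hc_le: "\<And>n. ereal_of_enat (Hc U (prefix_bits \<alpha> n)) \<le>
      ereal ((T + \<epsilon> / 2) * real n + D)"
    using assms[of "T + \<epsilon> / 2"] by auto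
  obtain n0 :: nat where n0_ge: "D / (\<epsilon> / 2) \<le> real n0" using real_arch_simple by blast
  have "eventually (\<lambda>n. ereal_of_enat (Hc U (prefix_bits \<alpha> n)) / ereal (real n) \<le> ereal (T + \<epsilon>))
      sequentially"
    using eventually_ge_at_top[of n0] eventually_gt_at_top[of 0]
  proof eventually_elim
    case (elim n)
    have "D / (\<epsilon> / 2) \<le> real n" using n0_ge elim(1) by linarith
    then have "D \<le> \<epsilon> / 2 * real n" using eps_pos by (simp add: field_simps)
    then have "((T + \<epsilon> / 2) * real n + D) / real n \<le> T + \<epsilon>"
      using elim(2) by (simp add: field_simps)
    moreover have "ereal_of_enat (Hc U (prefix_bits \<alpha> n)) / ereal (real n) \<le>
        ereal ((T + \<epsilon> / 2) * real n + D) / ereal (real n)"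
      using Hc_le elim(2) by (intro ereal_divide_right_mono) auto
    ultimately show ?case using elim(2) by (auto intro: order_trans)
  qed
  then show "limsup (\<lambda>n. ereal_of_enat (Hc U (prefix_bits \<alpha> n)) / ereal (real n)) \<le>
      ereal T + ereal \<epsilon>"
    by (simp add: Limsup_bounded)
qed

lemma (in computable_partition_function) compressible_T:
  assumes optimal_U: "optimal_machine U"
  shows "compressible U T T"
proof (rule compressibleI)
  fix y assume T_less_y: "T < y"
  obtain K :: nat where K_large: "2 / (y - T) < real K" using reals_Archimedean2 by blast
  have "0 < 2 / (y - T)" using T_less_y by simp
  with K_large have K_pos: "0 < real K" by linarith
  define M where "M = nat \<lceil>real K * T\<rceil>"
  have M_bounds: "real K * T \<le> real M" "real M < real K * T + 1"
    using T_pos by (simp_all add: M_def) linarith+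
  have slope: "(real M + 1) / real K \<le> y"
    using M_bounds(2) K_large K_pos T_less_y by (simp add: field_simps)
  obtain D where Hc_le: "\<And>n. ereal_of_enat (Hc U (prefix_bits T n)) \<le>
      ereal ((real M + 1) / real K * real n + D)"
    using ex_Hc_prefix_bits_le_linear[OF optimal_U _ M_bounds(1)] K_pos by auto
  have "ereal_of_enat (Hc U (prefix_bits T n)) \<le> ereal (y * real n + D)" for n
  proof -
    have "(real M + 1) / real K * real n + D \<le> y * real n + D"
      using slope by (intro add_right_mono mult_right_mono) auto
    with Hc_le[of n] show ?thesis by (meson ereal_less_eq(3) order_trans)
  qed
  then show "\<exists>D. \<forall>n. ereal_of_enat (Hc U (prefix_bits T n)) \<le> ereal (y * real n + D)" by blast
qed

section \<open>Computable values of the partition function\<close>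

lemma kraft_enumeration_compressible_strings:
  assumes machine_V: "prefix_free_machine V"
  obtains A where "kraft_enumeration A" and "(\<Union>k. A k) = str_code ` compressible_strings V"
proof -
  obtain A where enumeration: "decidable2 (\<lambda>k c. c \<in> A k)" "\<And>k. A k \<subseteq> {..<k}" "mono A"
    "(\<Union>k. A k) = str_code ` compressible_strings V"
    by (rule compressible_strings_enumerable[OF machine_V]) blast
  have "sum (weight 1) F \<le> 1/2" if listed: "finite F" "F \<subseteq> (\<Union>k. A k)" for F
  proof -
    have "str_decode ` F \<subseteq> compressible_strings V" using listed(2) enumeration(4) by auto
    then have "(\<Sum>s\<in>str_decode ` F. (1/2 :: real) ^ length s) \<le> 1/2"
      using listed(1) by (intro kraft_compressible_strings[OF machine_V]) auto
    moreover have "inj_on str_decode F" by (metis inj_onI str_code_decode)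
    ultimately show ?thesis by (simp add: sum.reindex weight_1)
  qed
  then have "kraft_enumeration A" using enumeration by unfold_locales
  then show ?thesis using that enumeration(4) by blast
qed

lemma Theta_eq_infsum_weight: "Theta V T = infsum (weight T) (str_code ` compressible_strings V)"
proof -
  have "inj_on str_code (compressible_strings V)"
    using inj_str_code by (rule inj_on_subset) simp
  then show ?thesis
    by (simp add: infsum_reindex comp_def weight_def Theta_def compressible_strings_def)
qed

lemma computable_partition_function_exists:
  assumes optimal_V: "optimal_machine V" and T_bounds: "0 < T" "T < 1"
    and computable: "computable_real (Theta V T)"
  obtains A P where "computable_partition_function A T (Theta V T) P"
    and "(\<Union>k. A k) = str_code ` compressible_strings V"
proof -
  obtain A where enumeration: "kraft_enumeration A" "(\<Union>k. A k) = str_code ` compressible_strings V"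
    using optimal_V by (auto simp: optimal_machine_def elim: kraft_enumeration_compressible_strings)
  interpret kraft_enumeration A by (fact enumeration)
  obtain P where test: "decidable3 P"
    "\<And>n s d. 0 < n \<Longrightarrow> 0 < d \<Longrightarrow> Theta V T - 2 / real n \<le> real s / real d \<Longrightarrow> P n s d"
    "\<And>n s d. 0 < n \<Longrightarrow> 0 < d \<Longrightarrow> P n s d \<Longrightarrow> Theta V T - 4 / real n < real s / real d"
    by (rule computable_real_lower_test[OF computable]) blast
  have "(weight T has_sum Theta V T) (\<Union>k. A k)"
    unfolding Theta_eq_infsum_weight enumeration(2)[symmetric]
    using T_bounds by (intro has_sum_infsum weight_summable) auto
  moreover have "(\<Union>k. A k) \<noteq> {}"
    using compressible_strings_nonempty[OF optimal_V] enumeration(2) by simp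
  ultimately have "computable_partition_function A T (Theta V T) P"
    using test T_bounds by unfold_locales
  then show ?thesis using that enumeration(2) by blast
qed

theorem theorem9:
  fixes U V :: "bool list \<Rightarrow> bool list option" and T :: real
  assumes "optimal_machine U" and "optimal_machine V"
    and "0 < T" and "T < 1"
    and "computable_real (Theta V T)"
  shows "weakly_Chaitin_random U T T \<and> compressible U T T"
proof -
  obtain A P where "computable_partition_function A T (Theta V T) P"
    and listed_eq: "(\<Union>k. A k) = str_code ` compressible_strings V"
    by (rule computable_partition_function_exists[OF assms(2-5)])
  then interpret computable_partition_function A T "Theta V T" P by simp
  show ?thesis
    using weakly_Chaitin_random_T[OF assms(1,2) listed_eq] compressible_T[OF assms(1)] by blast
qed

end
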